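(* For complex $q$ with $|q|<1$ let $$P(q) := \frac{E(q)E(q^6)E(q^{10})E(q^{15})}{E(q^2)E(q^{30})}, \qquad Q(q) := q \frac{E(q^2)E(q^3)E(q^5)E(q^{30})}{E(q^6)E(q^{10})}.$$ Then $$P(q) = 1 - \sum_{n=1}^{\infty} \left(\frac{-15}{n}\right) \frac{q^n}{1+q^n}, \qquad Q(q) = \sum_{n=1}^{\infty} \left(\frac{5}{n}\right) \frac{q^n(1+q^n)}{1+q^{3n}}.$$ Moreover, $$\varphi(-q)\varphi(-q^{15}) = P(q) - Q(q) = 1 - \sum_{n=1}^{\infty} \left(\frac{-15}{n}\right) \frac{q^n}{1+q^n} - \sum_{n=1}^{\infty} \left(\frac{5}{n}\right) \frac{q^n(1+q^n)}{1+q^{3n}}$$ and $$\varphi(-q^3)\varphi(-q^5) = P(q) + Q(q) = 1 - \sum_{n=1}^{\infty} \left(\frac{-15}{n}\right) \frac{q^n}{1+q^n} + \sum_{n=1}^{\infty} \left(\frac{5}{n}\right) \frac{q^n(1+q^n)}{1+q^{3n}}.$$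
   Context: For $|q|<1$: $E(q):=\prod_{n\ge 1}(1-q^n)$ and $\varphi(q):=\sum_{n=-\infty}^{\infty} q^{n^2}$. $\left(\frac{a}{n}\right)$ denotes the Kronecker symbol. *)

theory Defs
  imports "HOL-Analysis.Analysis" "HOL-Number_Theory.Number_Theory"
begin

definition kronecker_prime :: "int \<Rightarrow> int \<Rightarrow> int" where
  "kronecker_prime a p =
     (if p = 2 then (if even a then 0 else if a mod 8 \<in> {1, 7} then 1 else - 1)
      else Legendre a p)"

(* The unit factor (a/-1) is -1 if a < 0 and 1 otherwise; (a/0) is 1 if a is a unit and
   0 otherwise.  On int, prime_factors yields the positive primes. *)
definition kronecker :: "int \<Rightarrow> int \<Rightarrow> int" where
  "kronecker a n =
     (if n = 0 then (if \<bar>a\<bar> = 1 then 1 else 0)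
      else (if n < 0 \<and> a < 0 then - 1 else 1) *
           (\<Prod>p\<in>prime_factors n. kronecker_prime a p ^ multiplicity p n))"

definition euler_E :: "complex \<Rightarrow> complex" where
  "euler_E q = (\<Prod>n. 1 - q ^ Suc n)"

definition theta_phi :: "complex \<Rightarrow> complex" where
  "theta_phi q = (\<Sum>\<^sub>\<infinity>n::int. q ^ nat (n\<^sup>2))"

definition P_quotient :: "complex \<Rightarrow> complex" where
  "P_quotient q =
     (euler_E q * euler_E (q ^ 6) * euler_E (q ^ 10) * euler_E (q ^ 15)) /
     (euler_E (q ^ 2) * euler_E (q ^ 30))"

definition Q_quotient :: "complex \<Rightarrow> complex" where
  "Q_quotient q =
     q * ((euler_E (q ^ 2) * euler_E (q ^ 3) * euler_E (q ^ 5) * euler_E (q ^ 30)) /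
          (euler_E (q ^ 6) * euler_E (q ^ 10)))"

(* The lemmas below show that for |q| < 1 every infinite product and series used here converges
   and every denominator is nonzero, so no default values of prodinf, infsum, suminf or
   division are involved. *)

lemma abs_kronecker_le_1: "\<bar>kronecker a n\<bar> \<le> 1"
proof -
  have "\<bar>kronecker_prime a p\<bar> \<le> 1" for p
    by (auto simp: kronecker_prime_def Legendre_def)
  hence "\<bar>\<Prod>p\<in>prime_factors n. kronecker_prime a p ^ multiplicity p n\<bar> \<le> 1"
    unfolding abs_prod by (intro prod_le_1) (auto simp: power_abs power_le_one)
  thus ?thesis
    by (auto simp: kronecker_def abs_mult)
qed

lemma
  fixes q :: complex
  assumes "norm q < 1"
  shows convergent_prod_euler_E: "convergent_prod (\<lambda>n. 1 - q ^ Suc n)"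
    and euler_E_nonzero: "euler_E q \<noteq> 0"
proof -
  have "summable (\<lambda>n. norm (- (q ^ Suc n)))"
    using assms by (simp add: norm_mult norm_power summable_mult)
  hence "abs_convergent_prod (\<lambda>n. 1 - q ^ Suc n)"
    by (simp add: abs_convergent_prod_conv_summable)
  thus c: "convergent_prod (\<lambda>n. 1 - q ^ Suc n)"
    by (rule abs_convergent_prod_imp_convergent_prod)
  have "1 - q ^ Suc n \<noteq> 0" for n
  proof
    assume "1 - q ^ Suc n = 0"
    hence "norm (q ^ Suc n) = 1" by simp
    moreover have "norm (q ^ Suc n) < 1"
      unfolding norm_power using assms by (cases "q = 0") (auto simp del: power_Suc intro: power_Suc_less_one)
    ultimately show False by simp
  qed
  thus "euler_E q \<noteq> 0"
    unfolding euler_E_def using prodinf_nonzero[OF c] by blast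
qed

lemma one_plus_power_nonzero:
  fixes q :: complex
  assumes "norm q < 1" "n > 0"
  shows "1 - norm q \<le> norm (1 + q ^ n)" "1 + q ^ n \<noteq> 0"
proof -
  have "norm q ^ n \<le> norm q ^ 1"
    using assms by (intro power_decreasing) auto
  moreover have "norm (1::complex) - norm (- (q ^ n)) \<le> norm (1 - (- (q ^ n)))"
    by (rule norm_triangle_ineq2)
  ultimately show *: "1 - norm q \<le> norm (1 + q ^ n)"
    by (simp add: norm_power)
  show "1 + q ^ n \<noteq> 0"
    using * assms by (metis diff_gt_0_iff_gt norm_zero not_le)
qed

lemma summable_kronecker_P:
  fixes q :: complex
  assumes "norm q < 1"
  shows "summable (\<lambda>n. of_int (kronecker a (int (Suc n))) * (q ^ Suc n / (1 + q ^ Suc n)))"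
proof (rule summable_comparison_test')
  show "summable (\<lambda>n. norm q ^ Suc n / (1 - norm q))"
    using assms by (intro summable_divide) (simp add: summable_mult)
  fix n :: nat
  have "norm (of_int (kronecker a (int (Suc n))) :: complex) \<le> 1"
    using abs_kronecker_le_1[of a "int (Suc n)"] by simp
  moreover have "norm (q ^ Suc n / (1 + q ^ Suc n)) \<le> norm q ^ Suc n / (1 - norm q)"
    unfolding norm_divide norm_power using one_plus_power_nonzero[OF assms, of "Suc n"] assms
    by (intro divide_left_mono) (auto simp del: power_Suc intro!: mult_pos_pos)
  ultimately have "norm (of_int (kronecker a (int (Suc n))) :: complex) *
      norm (q ^ Suc n / (1 + q ^ Suc n)) \<le> 1 * (norm q ^ Suc n / (1 - norm q))"
    by (intro mult_mono) auto
  thus "norm (of_int (kronecker a (int (Suc n))) * (q ^ Suc n / (1 + q ^ Suc n)))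
        \<le> norm q ^ Suc n / (1 - norm q)"
    by (simp only: norm_mult mult_1)
qed

lemma summable_kronecker_Q:
  fixes q :: complex
  assumes "norm q < 1"
  shows "summable (\<lambda>n. of_int (kronecker a (int (Suc n))) *
           (q ^ Suc n * (1 + q ^ Suc n) / (1 + q ^ (3 * Suc n))))"
proof (rule summable_comparison_test')
  show "summable (\<lambda>n. norm q ^ Suc n * 2 / (1 - norm q))"
    using assms by (intro summable_divide summable_mult2) (simp add: summable_mult)
  fix n :: nat
  have "norm (of_int (kronecker a (int (Suc n))) :: complex) \<le> 1"
    using abs_kronecker_le_1[of a "int (Suc n)"] by simp
  moreover have "norm (q ^ Suc n * (1 + q ^ Suc n) / (1 + q ^ (3 * Suc n)))
      \<le> norm q ^ Suc n * 2 / (1 - norm q)"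
  proof -
    have "norm (1 + q ^ Suc n) \<le> norm (1::complex) + norm (q ^ Suc n)"
      by (rule norm_triangle_ineq)
    also have "norm (q ^ Suc n) \<le> 1"
      unfolding norm_power using assms by (intro power_le_one) auto
    finally have "norm (1 + q ^ Suc n) \<le> 2" by simp
    thus ?thesis
      unfolding norm_divide norm_mult norm_power
      using one_plus_power_nonzero[OF assms, of "3 * Suc n"] assms
      by (intro frac_le mult_left_mono) (auto simp del: power_Suc)
  qed
  ultimately have "norm (of_int (kronecker a (int (Suc n))) :: complex) *
      norm (q ^ Suc n * (1 + q ^ Suc n) / (1 + q ^ (3 * Suc n)))
      \<le> 1 * (norm q ^ Suc n * 2 / (1 - norm q))"
    by (intro mult_mono) auto
  thus "norm (of_int (kronecker a (int (Suc n))) *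
          (q ^ Suc n * (1 + q ^ Suc n) / (1 + q ^ (3 * Suc n))))
        \<le> norm q ^ Suc n * 2 / (1 - norm q)"
    by (simp only: norm_mult mult_1)
qed

lemma theta_phi_summable:
  fixes q :: complex
  assumes "norm q < 1"
  shows "(\<lambda>n::int. q ^ nat (n\<^sup>2)) summable_on UNIV"
proof -
  let ?f = "\<lambda>n::int. q ^ nat (n\<^sup>2)"
  have s: "(\<lambda>n::nat. norm q ^ n) summable_on UNIV"
    using assms by (intro summable_nonneg_imp_summable_on) (auto simp: summable_geometric)
  have n: "(\<lambda>n::nat. norm (?f (g n))) summable_on UNIV" if "\<And>n. \<bar>g n\<bar> = int n" for g
  proof (rule summable_on_comparison_test[OF s])
    fix n :: nat
    have "(g n)\<^sup>2 = (int n)\<^sup>2"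
      using that[of n] by (metis power2_abs)
    hence "nat ((g n)\<^sup>2) = n\<^sup>2"
      by (simp flip: of_nat_power)
    thus "norm (?f (g n)) \<le> norm q ^ n"
      using assms by (simp add: norm_power power_decreasing power2_eq_square)
  qed auto
  have "?f summable_on range int"
    using abs_summable_summable[OF n[of int]] by (subst summable_on_reindex) (auto simp: o_def)
  moreover have "?f summable_on range (\<lambda>n. - int n)"
    using abs_summable_summable[OF n[of "\<lambda>n. - int n"]]
    by (subst summable_on_reindex) (auto simp: o_def inj_on_def)
  ultimately have "?f summable_on (range int \<union> range (\<lambda>n. - int n))"
    by (rule summable_on_union)
  moreover have "range int \<union> range (\<lambda>n. - int n) = UNIV"
    by (auto simp: image_iff) (metis int_cases2)
  ultimately show ?thesis by simp
qed

end

theory Submission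
  imports Defs "HOL-Complex_Analysis.Complex_Analysis"
begin

text \<open>
  Put \<open>j(z) = (z; p)\<^sub>\<infinity> (p/z; p)\<^sub>\<infinity>\<close> and let \<open>\<zeta>(z) = - z j'(z) / j(z)\<close>, which is a Lambert series. Liouville's
  theorem gives
  \<open>\<zeta>(a) + \<zeta>(b) + \<zeta>(c) - \<zeta>(abc) + 1 = E(p)\<^sup>2 j(ab) j(ac) j(bc) / (j(a) j(b) j(c) j(abc))\<close>.
  The series for \<open>P\<close> is the case \<open>p = q^15\<close>, \<open>(a, b, c) = (-q, -q^2, -q^4)\<close>; the one for \<open>Q\<close> is the
  case \<open>p = q^5\<close>, \<open>(a, b, c) = (\<alpha> q, q^2/\<alpha>, \<alpha>/q)\<close> with \<open>\<alpha>\<close> a primitive sixth root of unity, because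
  \<open>x (1 + x) / (1 + x^3)\<close> has its poles at \<open>\<alpha>\<close> and \<open>1/\<alpha>\<close>.

  For the theta products, with \<open>\<psi>(q) = \<Sum> q^(n(n+1)/2)\<close> over \<open>n \<ge> 0\<close>, regrouping lattice points modulo 8 gives
  \<open>\<phi>(q^3) \<phi>(q^5) = \<phi>(-q^2) \<phi>(-q^30) + 2 q^2 \<psi>(q) \<psi>(q^15)\<close> and
  \<open>\<phi>(q) \<phi>(q^15) = \<phi>(-q^6) \<phi>(-q^10) + 2 q \<psi>(q^3) \<psi>(q^5)\<close>.
  Together with their images under \<open>q \<mapsto> -q\<close>, and with \<open>\<phi>\<close> and \<open>\<psi>\<close> written as products by the Jacobi triple product,
  these relations determine \<open>P^3\<close> and \<open>Q P^2\<close> in terms of the theta products. Extracting the cube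
  root near \<open>q = 0\<close> and continuing analytically yields the last two identities.
\<close>

section \<open>The q-Pochhammer symbol\<close>

text \<open>Built into j is the symmetry z -> p/z. For P it sends -q^s to -q^(15-s), and the odd
  character (-15/n) changes sign between s and 15 - s. The character (5/n) is even; there the change
  of sign comes from the partial fractions, since \<alpha> q^s goes to q^(5-s)/\<alpha>. The
  constant 1 in the four-term identity is the leading 1 of the series for P. For Q it must
  disappear: this is why the third argument is \<alpha>/q and not \<alpha> q^4 = p \<alpha>/q, as
  \<zeta>(p z) = \<zeta>(z) + 1. The two rational isometries are the same one: conjugation followed
  by multiplication by (1 + sqrt(-15))/4, a number of norm 1 that is not an algebraic integer. It
  therefore preserves the form but is integral only on certain classes modulo 8. With a, b the theta
  products to be found, elimination gives only (2 P)^3 = (a + b)^3, and on the way it cancels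
  expressions that are known to be nonzero only near q = 0. There 2 P and a + b both tend to 2,
  which excludes the other cube roots of unity.\<close>

lemma uniform_limit_prodinf_majorant:
  fixes f :: "nat \<Rightarrow> 'a::topological_space \<Rightarrow> 'b::{real_normed_field,banach}"
  assumes "compact A" and "\<And>n. continuous_on A (f n)"
    and M: "\<And>n x. x \<in> A \<Longrightarrow> norm (f n x - 1) \<le> M n" and "summable M"
  shows "uniform_limit A (\<lambda>N x. \<Prod>n<N. f n x) (\<lambda>x. \<Prod>n. f n x) sequentially"
proof -
  have "uniformly_convergent_on A (\<lambda>N x. \<Sum>n<N. norm (f n x - 1))"
    using Weierstrass_m_test[of A "\<lambda>n x. norm (f n x - 1)" M] assms(4) M
    by (auto simp: uniformly_convergent_on_def)
  hence "uniformly_convergent_on A (\<lambda>N x. \<Prod>n<N. f n x)"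
    using assms by (intro uniformly_convergent_on_prod')
  then obtain g where g: "uniform_limit A (\<lambda>N x. \<Prod>n<N. f n x) g sequentially"
    by (auto simp: uniformly_convergent_on_def)
  have "g x = (\<Prod>n. f n x)" if "x \<in> A" for x
  proof -
    have "summable (\<lambda>n. norm (f n x - 1))"
      by (rule summable_comparison_test'[OF assms(4)]) (use M that in auto)
    hence "convergent_prod (\<lambda>n. f n x)"
      by (intro abs_convergent_prod_imp_convergent_prod)
         (simp add: abs_convergent_prod_conv_summable)
    hence "(\<lambda>N. \<Prod>n<N. f n x) \<longlonglongrightarrow> (\<Prod>n. f n x)"
      by (simp add: LIMSEQ_lessThan_iff_atMost convergent_prod_LIMSEQ)
    thus ?thesis
      using tendsto_uniform_limitI[OF g that] LIMSEQ_unique by blast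
  qed
  with g show ?thesis
    by (metis (no_types, lifting) uniform_limit_cong')
qed

text \<open>The majorant is local, on a closed disc around each point: for Euler's product no single
  summable majorant works on the whole unit disc.\<close>

lemma holomorphic_prodinf_majorant:
  fixes f :: "nat \<Rightarrow> complex \<Rightarrow> complex"
  assumes "open S" and "\<And>n. f n holomorphic_on S"
    and "\<And>x. x \<in> S \<Longrightarrow> \<exists>d>0. cball x d \<subseteq> S \<and>
           (\<exists>M. summable M \<and> (\<forall>n. \<forall>z\<in>cball x d. norm (f n z - 1) \<le> M n))"
  shows "(\<lambda>z. \<Prod>n. f n z) holomorphic_on S"
proof (rule holomorphic_uniform_sequence[OF assms(1)])
  show "(\<lambda>z. \<Prod>n<N. f n z) holomorphic_on S" for N
    by (intro holomorphic_intros assms)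
  fix x assume "x \<in> S"
  then obtain d M where d: "d > 0" "cball x d \<subseteq> S" "summable M"
      "\<And>n z. z \<in> cball x d \<Longrightarrow> norm (f n z - 1) \<le> M n"
    using assms(3) by metis
  have "uniform_limit (cball x d) (\<lambda>N z. \<Prod>n<N. f n z) (\<lambda>z. \<Prod>n. f n z) sequentially"
    using d assms(2)
    by (intro uniform_limit_prodinf_majorant[where M = M] compact_cball
          holomorphic_on_imp_continuous_on) (blast intro: holomorphic_on_subset)+
  with d show "\<exists>d>0. cball x d \<subseteq> S \<and>
      uniform_limit (cball x d) (\<lambda>N z. \<Prod>n<N. f n z) (\<lambda>z. \<Prod>n. f n z) sequentially"
    by blast
qed

definition qpoch :: "complex \<Rightarrow> complex \<Rightarrow> complex" where
  "qpoch z p = (\<Prod>n. 1 - z * p ^ n)"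

lemma convergent_prod_qpoch:
  fixes p z :: complex
  assumes "norm p < 1"
  shows "convergent_prod (\<lambda>n. 1 - z * p ^ n)"
proof -
  have "summable (\<lambda>n. norm (- (z * p ^ n)))"
    using assms by (auto simp: norm_mult norm_power intro!: summable_mult summable_geometric)
  hence "abs_convergent_prod (\<lambda>n. 1 - z * p ^ n)"
    by (simp add: abs_convergent_prod_conv_summable)
  thus ?thesis
    by (rule abs_convergent_prod_imp_convergent_prod)
qed

lemma qpoch_LIMSEQ:
  assumes "norm p < 1"
  shows "(\<lambda>n. \<Prod>k<n. 1 - z * p ^ k) \<longlonglongrightarrow> qpoch z p"
  using convergent_prod_LIMSEQ[OF convergent_prod_qpoch[OF assms]]
  by (simp add: LIMSEQ_lessThan_iff_atMost qpoch_def)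

lemma qpoch_eq_0_iff:
  assumes "norm p < 1"
  shows "qpoch z p = 0 \<longleftrightarrow> (\<exists>n. z * p ^ n = 1)"
  unfolding qpoch_def
  using has_prod_eq_0_iff[OF convergent_prod_has_prod[OF convergent_prod_qpoch[OF assms, of z]]]
  by (auto simp: image_iff)

lemma qpoch_nonzero:
  assumes "norm p < 1" "norm z < 1"
  shows "qpoch z p \<noteq> 0"
proof
  assume "qpoch z p = 0"
  then obtain n where "z * p ^ n = 1"
    using qpoch_eq_0_iff assms by blast
  moreover have "norm (z * p ^ n) < 1"
    unfolding norm_mult norm_power using assms
    by (meson mult_left_le norm_ge_zero order_le_less_trans power_le_one less_imp_le)
  ultimately show False by simp
qed

lemma euler_E_eq_qpoch: "euler_E q = qpoch q q"
  by (simp add: euler_E_def qpoch_def)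

lemma qpoch_rec:
  assumes "norm p < 1"
  shows "qpoch z p = (1 - z) * qpoch (z * p) p"
proof (rule LIMSEQ_unique)
  show "(\<lambda>n. \<Prod>k<Suc n. 1 - z * p ^ k) \<longlonglongrightarrow> qpoch z p"
    using qpoch_LIMSEQ[OF assms] by (rule LIMSEQ_Suc)
  have "(\<Prod>k<Suc n. 1 - z * p ^ k) = (1 - z) * (\<Prod>k<n. 1 - z * p * p ^ k)" for n
    by (subst prod.lessThan_Suc_shift) (simp add: mult_ac)
  thus "(\<lambda>n. \<Prod>k<Suc n. 1 - z * p ^ k) \<longlonglongrightarrow> (1 - z) * qpoch (z * p) p"
    using tendsto_mult_left[OF qpoch_LIMSEQ[OF assms]] by simp
qed

lemma prod_nested_lessThan:
  fixes f :: "nat \<Rightarrow> 'a::comm_monoid_mult"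
  shows "(\<Prod>k<m * n. f k) = (\<Prod>r<m. \<Prod>k<n. f (r + m * k))"
proof (induction n)
  case (Suc n)
  have "(\<Prod>k<m * Suc n. f k) = (\<Prod>k<m * n. f k) * (\<Prod>k=m*n..<m*n+m. f k)"
    by (simp add: add.commute lessThan_atLeast0 prod.atLeastLessThan_concat)
  also have "(\<Prod>k=m*n..<m*n+m. f k) = (\<Prod>r<m. f (r + m * n))"
    using prod.shift_bounds_nat_ivl[of f 0 "m * n" m] by (simp add: lessThan_atLeast0 add.commute)
  finally show ?case
    using Suc by (simp add: prod.distrib)
qed auto

text \<open>Sorting exponents by their residue modulo \<open>m\<close> is a finite rearrangement of
  the partial products of length \<open>m * n\<close>; the limit is then taken along this
  subsequence.\<close>

lemma qpoch_split:
  assumes "norm p < 1" "m > 0"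
  shows "qpoch z p = (\<Prod>r<m. qpoch (z * p ^ r) (p ^ m))"
proof (rule LIMSEQ_unique)
  have "norm (p ^ m) < 1"
    using assms by (simp add: norm_power power_less_one_iff)
  hence "(\<lambda>n. \<Prod>r<m. \<Prod>k<n. 1 - z * p ^ r * (p ^ m) ^ k) \<longlonglongrightarrow>
           (\<Prod>r<m. qpoch (z * p ^ r) (p ^ m))"
    by (intro tendsto_prod qpoch_LIMSEQ)
  also have "(\<lambda>n. \<Prod>r<m. \<Prod>k<n. 1 - z * p ^ r * (p ^ m) ^ k) = (\<lambda>n. \<Prod>k<m*n. 1 - z * p ^ k)"
    by (simp only: prod_nested_lessThan[of _ m] power_add power_mult mult.assoc)
  finally show "(\<lambda>n. \<Prod>k<m*n. 1 - z * p ^ k) \<longlonglongrightarrow> (\<Prod>r<m. qpoch (z * p ^ r) (p ^ m))" .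
  have "filterlim (\<lambda>n. m * n) at_top at_top"
    using assms by (simp add: filterlim_at_top_mono[OF filterlim_ident] eventually_sequentiallyI)
  from filterlim_compose[OF qpoch_LIMSEQ[OF assms(1)] this]
  show "(\<lambda>n. \<Prod>k<m*n. 1 - z * p ^ k) \<longlonglongrightarrow> qpoch z p" .
qed

lemma qpoch_mult_uminus:
  assumes "norm p < 1"
  shows "qpoch z p * qpoch (- z) p = qpoch (z\<^sup>2) (p\<^sup>2)"
proof (rule LIMSEQ_unique)
  show "(\<lambda>n. (\<Prod>k<n. 1 - z * p ^ k) * (\<Prod>k<n. 1 - (- z) * p ^ k)) \<longlonglongrightarrow>
          qpoch z p * qpoch (- z) p"
    by (intro tendsto_mult qpoch_LIMSEQ assms)
  have "norm (p\<^sup>2) < 1"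
    using assms by (simp add: norm_power power_less_one_iff)
  moreover have "(1 - z * p ^ k) * (1 - (- z) * p ^ k) = 1 - z\<^sup>2 * (p\<^sup>2) ^ k" for k
    by (simp add: algebra_simps power2_eq_square power_mult_distrib)
  ultimately show "(\<lambda>n. (\<Prod>k<n. 1 - z * p ^ k) * (\<Prod>k<n. 1 - (- z) * p ^ k)) \<longlonglongrightarrow>
          qpoch (z\<^sup>2) (p\<^sup>2)"
    using qpoch_LIMSEQ[of "p\<^sup>2" "z\<^sup>2"] by (simp flip: prod.distrib)
qed

lemma qpoch_uminus_self:
  assumes "norm q < 1"
  shows "qpoch (- q) q = euler_E (q\<^sup>2) / euler_E q"
  using qpoch_mult_uminus[OF assms, of q] euler_E_nonzero[OF assms]
  by (simp add: euler_E_eq_qpoch field_simps)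

text \<open>The assumptions say that \<alpha> and \<beta> are the primitive sixth roots of unity, so
  factor by factor this is (1 - w + w^2)(1 + w) = 1 + w^3.\<close>

lemma qpoch_mult_sixth_roots:
  assumes "norm p < 1" "\<alpha> + \<beta> = 1" "\<alpha> * \<beta> = 1"
  shows "qpoch (\<alpha> * z) p * qpoch (\<beta> * z) p * qpoch (- z) p = qpoch (- (z ^ 3)) (p ^ 3)"
proof (rule LIMSEQ_unique)
  show "(\<lambda>n. (\<Prod>k<n. 1 - \<alpha> * z * p ^ k) * (\<Prod>k<n. 1 - \<beta> * z * p ^ k) *
               (\<Prod>k<n. 1 - (- z) * p ^ k)) \<longlonglongrightarrow>
          qpoch (\<alpha> * z) p * qpoch (\<beta> * z) p * qpoch (- z) p"
    by (intro tendsto_mult qpoch_LIMSEQ assms)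
  have "norm (p ^ 3) < 1"
    using assms by (simp add: norm_power power_less_one_iff)
  moreover have "(1 - \<alpha> * z * p ^ k) * (1 - \<beta> * z * p ^ k) * (1 - (- z) * p ^ k) =
          1 - (- (z ^ 3)) * (p ^ 3) ^ k" for k
  proof -
    have "(1 - \<alpha> * w) * (1 - \<beta> * w) * (1 + w) = 1 + w ^ 3" for w
    proof -
      have "(1 - \<alpha> * w) * (1 - \<beta> * w) = 1 - (\<alpha> + \<beta>) * w + \<alpha> * \<beta> * w\<^sup>2"
        by (simp add: algebra_simps power2_eq_square)
      also have "\<dots> * (1 + w) = 1 + w ^ 3"
        unfolding assms by (simp add: algebra_simps power2_eq_square power3_eq_cube)
      finally show ?thesis .
    qed
    from this[of "z * p ^ k"] show ?thesis
      by (simp add: power_mult_distrib mult.assoc) (simp add: power_mult[symmetric] mult.commute)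
  qed
  ultimately show "(\<lambda>n. (\<Prod>k<n. 1 - \<alpha> * z * p ^ k) * (\<Prod>k<n. 1 - \<beta> * z * p ^ k) *
               (\<Prod>k<n. 1 - (- z) * p ^ k)) \<longlonglongrightarrow> qpoch (- (z ^ 3)) (p ^ 3)"
    using qpoch_LIMSEQ[of "p ^ 3" "- (z ^ 3)"] by (simp flip: prod.distrib)
qed

lemma uniform_limit_qpoch:
  assumes "norm p < 1"
  shows "uniform_limit (cball 0 R) (\<lambda>N z. \<Prod>n<N. 1 - z * p ^ n) (\<lambda>z. qpoch z p) sequentially"
  unfolding qpoch_def
proof (rule uniform_limit_prodinf_majorant)
  show "summable (\<lambda>n. R * norm p ^ n)"
    using assms by (intro summable_mult) (simp add: summable_geometric)
qed (auto intro!: continuous_intros mult_right_mono simp: norm_mult norm_power)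

lemma holomorphic_qpoch [holomorphic_intros]:
  assumes "norm p < 1" "f holomorphic_on S"
  shows "(\<lambda>z. qpoch (f z) p) holomorphic_on S"
proof -
  have "(\<lambda>z. \<Prod>n. 1 - z * p ^ n) holomorphic_on UNIV"
  proof (rule holomorphic_prodinf_majorant)
    fix x :: complex
    have "summable (\<lambda>n. (norm x + 1) * norm p ^ n)"
      using assms by (intro summable_mult) (simp add: summable_geometric)
    moreover have "norm (1 - z * p ^ n - 1) \<le> (norm x + 1) * norm p ^ n" if "z \<in> cball x 1" for n z
    proof -
      have "norm z \<le> norm x + 1"
        using that norm_triangle_ineq2[of z x] by (simp add: dist_norm norm_minus_commute)
      thus ?thesis
        by (simp add: norm_mult norm_power mult_right_mono)
    qed
    ultimately show "\<exists>d>0. cball x d \<subseteq> UNIV \<and> (\<exists>M. summable M \<and>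
        (\<forall>n. \<forall>z\<in>cball x d. norm (1 - z * p ^ n - 1) \<le> M n))"
      using zero_less_one by blast
  qed (auto intro!: holomorphic_intros)
  hence "(\<lambda>z. qpoch z p) holomorphic_on UNIV"
    by (simp add: qpoch_def)
  from holomorphic_on_compose_gen[OF assms(2) this] show ?thesis
    by (simp add: o_def)
qed

text \<open>Locally uniform convergence permits termwise logarithmic differentiation; the factor
  \<open>- z\<close> turns the result into a Lambert series.\<close>

lemma logderiv_qpoch:
  assumes "norm p < 1" "qpoch z p \<noteq> 0"
  shows "(\<lambda>n. z * p ^ n / (1 - z * p ^ n)) sums (- z * deriv (\<lambda>w. qpoch w p) z / qpoch z p)"
proof -
  have "(\<lambda>n. deriv (\<lambda>w. 1 - w * p ^ n) z / (1 - z * p ^ n)) sums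
          (deriv (\<lambda>w. qpoch w p) z / qpoch z p)"
  proof (rule logderiv_prodinf_complex_uniform_limit[where A = "ball 0 (norm z + 1)"])
    show "uniform_limit (ball 0 (norm z + 1)) (\<lambda>N z. \<Prod>n<N. 1 - z * p ^ n)
            (\<lambda>z. qpoch z p) sequentially"
      using uniform_limit_qpoch[OF assms(1), of "norm z + 1"]
      by (rule uniform_limit_on_subset) auto
  qed (use assms in \<open>auto intro!: holomorphic_intros\<close>)
  moreover have "deriv (\<lambda>w. 1 - w * p ^ n) z = - (p ^ n)" for n
    by (rule DERIV_imp_deriv) (auto intro!: derivative_eq_intros)
  ultimately show ?thesis
    using sums_mult[of "\<lambda>n. - (p ^ n) / (1 - z * p ^ n)" _ "- z"] by fastforce
qed

text \<open>Base and argument of the Pochhammer symbol vary together here, so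
  \<open>holomorphic_qpoch\<close>, with its fixed base, does not apply. Near \<open>x\<close> the
  factors are compared with powers of a radius strictly between |x| and 1.\<close>

lemma holomorphic_euler_E: "euler_E holomorphic_on ball 0 1"
  unfolding euler_E_def
proof (rule holomorphic_prodinf_majorant)
  fix x :: complex assume x: "x \<in> ball 0 1"
  define r where "r = (1 + norm x) / 2"
  have r: "norm x < r" "r < 1" "r \<ge> 0" using x by (auto simp: r_def field_simps)
  have z: "norm z \<le> r" if "z \<in> cball x (r - norm x)" for z
    using that norm_triangle_ineq2[of z x] by (simp add: dist_norm norm_minus_commute)
  have "norm (1 - z ^ Suc n - 1) \<le> r ^ Suc n" if "z \<in> cball x (r - norm x)" for n z
    using power_mono[OF z[OF that], of "Suc n"] by (simp add: norm_power norm_mult)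
  moreover have "summable (\<lambda>n. r ^ Suc n)"
    using r by (subst summable_Suc_iff) (simp add: summable_geometric)
  moreover have "cball x (r - norm x) \<subseteq> ball 0 1"
    using z r by fastforce
  ultimately show "\<exists>d>0. cball x d \<subseteq> ball 0 1 \<and> (\<exists>M. summable M \<and>
        (\<forall>n. \<forall>z\<in>cball x d. norm (1 - z ^ Suc n - 1) \<le> M n))"
    using r by (intro exI[of _ "r - norm x"] conjI exI[of _ "\<lambda>n. r ^ Suc n"]) simp_all
qed (auto intro!: holomorphic_intros)

section \<open>A four-term identity for theta quotients\<close>

lemma powi_periodic:
  fixes f :: "complex \<Rightarrow> 'a"
  assumes "p \<noteq> 0" "\<And>z. z \<noteq> 0 \<Longrightarrow> f (p * z) = f z" "z \<noteq> 0"
  shows "f (p powi k * z) = f z"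
proof (induction k rule: int_induct[where k = 0])
  case (step1 k)
  have "f (p powi (k + 1) * z) = f (p * (p powi k * z))"
    using assms by (simp add: power_int_add mult_ac)
  with step1 assms show ?case by simp
next
  case (step2 k)
  have "f (p powi k * z) = f (p * (p powi (k - 1) * z))"
    using assms by (simp add: power_int_diff)
  with step2 assms show ?case by simp
qed simp

text \<open>An elliptic function without poles is constant, in multiplicative form. Invariance under
  multiplication by \<open>p\<close> moves every point into the compact annulus between |p| and 1,
  so the pullback along \<open>exp\<close> is a bounded entire function.\<close>

lemma periodic_holomorphic_constant:
  fixes f :: "complex \<Rightarrow> complex"
  assumes p: "norm p < 1" "p \<noteq> 0" and f: "f holomorphic_on - {0}"
    and per: "\<And>z. z \<noteq> 0 \<Longrightarrow> f (p * z) = f z" and "z \<noteq> 0" "w \<noteq> 0"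
  shows "f z = f w"
proof -
  let ?K = "cball 0 1 - ball 0 (norm p) :: complex set"
  have "continuous_on ?K f"
    using holomorphic_on_imp_continuous_on[OF f] by (rule continuous_on_subset) (use p in auto)
  moreover have "compact ?K"
    by (intro compact_diff) auto
  ultimately have bdd: "bounded (f ` ?K)"
    using compact_continuous_image compact_imp_bounded by blast
  have "f (exp u) \<in> f ` ?K" for u
  proof -
    \<comment> \<open>\<open>x\<close> is the logarithm of |exp u| to the base |p|; removing its
      integer part by a power of \<open>p\<close> lands in the annulus.\<close>
    define x where "x = Re u / ln (norm p)"
    have lnp: "ln (norm p) < 0" using p by simp
    define y where "y = p powi (- \<lfloor>x\<rfloor>) * exp u"
    have u: "Re u = x * ln (norm p)" using lnp by (simp add: x_def)
    have "norm y = norm p powr (real_of_int (- \<lfloor>x\<rfloor>)) * exp (Re u)"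
      unfolding y_def norm_mult norm_power_int norm_exp_eq_Re
      using p by (subst powr_real_of_int') auto
    also have "\<dots> = exp ((x - \<lfloor>x\<rfloor>) * ln (norm p))"
      using p by (simp add: powr_def u exp_add[symmetric] algebra_simps)
    finally have y: "norm y = exp ((x - \<lfloor>x\<rfloor>) * ln (norm p))" .
    have fr: "0 \<le> x - \<lfloor>x\<rfloor>" "x - \<lfloor>x\<rfloor> \<le> 1" by linarith+
    have "(x - \<lfloor>x\<rfloor>) * ln (norm p) \<le> 0"
      using fr lnp by (simp add: mult_nonneg_nonpos)
    moreover have "ln (norm p) \<le> (x - \<lfloor>x\<rfloor>) * ln (norm p)"
      using mult_right_mono_neg[OF fr(2), of "ln (norm p)"] lnp by simp
    hence "norm p \<le> exp ((x - \<lfloor>x\<rfloor>) * ln (norm p))"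
      using p by (metis exp_le_cancel_iff exp_ln zero_less_norm_iff)
    ultimately have "y \<in> ?K"
      using y by simp
    moreover have "f y = f (exp u)"
      unfolding y_def by (rule powi_periodic) (use p per in auto)
    ultimately show ?thesis by (metis imageI)
  qed
  hence "bounded (range (\<lambda>u. f (exp u)))"
    using bdd by (meson bounded_subset image_subsetI)
  moreover have "(f \<circ> exp) holomorphic_on UNIV"
    by (rule holomorphic_on_compose_gen[OF _ f]) (auto intro!: holomorphic_intros)
  ultimately have "(f \<circ> exp) constant_on UNIV"
    by (intro Liouville_theorem) (auto simp: o_def)
  then obtain c where "f (exp u) = c" for u
    by (auto simp: constant_on_def)
  thus ?thesis
    using assms(5,6) by (metis exp_Ln)
qed

section \<open>The theta function j, its zeros and its logarithmic derivative\<close>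

definition theta_prod :: "complex \<Rightarrow> complex \<Rightarrow> complex" where
  "theta_prod p z = qpoch z p * qpoch (p / z) p"

definition lambert :: "complex \<Rightarrow> complex \<Rightarrow> complex" where
  "lambert p z = (\<Sum>n. z * p ^ n / (1 - z * p ^ n))"

text \<open>This is -z j'(z), written without a quotient so that it also makes sense at the zeros of
  j.\<close>

definition theta_der :: "complex \<Rightarrow> complex \<Rightarrow> complex" where
  "theta_der p z = (p / z) * deriv (\<lambda>w. qpoch w p) (p / z) * qpoch z p
     - z * deriv (\<lambda>w. qpoch w p) z * qpoch (p / z) p"

definition theta_zeta :: "complex \<Rightarrow> complex \<Rightarrow> complex" where
  "theta_zeta p z = theta_der p z / theta_prod p z"

lemma theta_prod_nonzero:
  assumes "norm p < norm z" "norm z < 1"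
  shows "theta_prod p z \<noteq> 0"
proof -
  have "norm p < 1" "norm (p / z) < 1"
    using assms by (auto simp: norm_divide divide_less_eq)
  thus ?thesis
    using assms by (simp add: theta_prod_def qpoch_nonzero)
qed

context
  fixes p :: complex
  assumes p: "norm p < 1" "p \<noteq> 0"
begin

lemma theta_zeta_eq_lambert:
  assumes "theta_prod p z \<noteq> 0"
  shows "theta_zeta p z = lambert p z - lambert p (p / z)"
proof -
  have nz: "qpoch z p \<noteq> 0" "qpoch (p / z) p \<noteq> 0"
    using assms by (auto simp: theta_prod_def)
  show ?thesis
    unfolding lambert_def logderiv_qpoch[OF p(1) nz(1), THEN sums_unique, symmetric]
      logderiv_qpoch[OF p(1) nz(2), THEN sums_unique, symmetric] theta_zeta_def
    using nz by (simp add: theta_der_def theta_prod_def field_simps)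
qed

lemma qpoch_has_deriv:
  "((\<lambda>w. qpoch w p) has_field_derivative deriv (\<lambda>w. qpoch w p) z) (at z)"
  by (rule holomorphic_derivI[of _ UNIV]) (auto intro!: holomorphic_intros p)

lemma deriv_qpoch_rec:
  "deriv (\<lambda>w. qpoch w p) z =
     (1 - z) * p * deriv (\<lambda>w. qpoch w p) (p * z) - qpoch (p * z) p"
proof -
  have "(\<lambda>w. qpoch w p) = (\<lambda>w. (1 - w) * qpoch (p * w) p)"
    by (subst qpoch_rec[OF p(1)]) (simp add: mult.commute)
  moreover have "((\<lambda>w. (1 - w) * qpoch (p * w) p) has_field_derivative
       (1 - z) * p * deriv (\<lambda>w. qpoch w p) (p * z) - qpoch (p * z) p) (at z)"
    by (rule derivative_eq_intros DERIV_chain2[OF qpoch_has_deriv] refl | simp)+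
  ultimately show ?thesis
    by (simp add: DERIV_imp_deriv)
qed

lemma theta_prod_shift:
  assumes "z \<noteq> 0"
  shows "theta_prod p (p * z) = - theta_prod p z / z"
proof -
  have "qpoch z p = (1 - z) * qpoch (p * z) p"
    using qpoch_rec[OF p(1), of z] by (simp add: mult.commute)
  moreover have "qpoch (1 / z) p = (1 - 1 / z) * qpoch (p / z) p"
    using qpoch_rec[OF p(1), of "1 / z"] by simp
  moreover have "p / (p * z) = 1 / z"
    using p(2) by simp
  ultimately show ?thesis
    using assms by (simp only: theta_prod_def) (simp add: field_simps)
qed

lemma theta_prod_inverse:
  assumes "z \<noteq> 0"
  shows "theta_prod p (1 / z) = - theta_prod p z / z"
  using theta_prod_shift[OF assms] p(2) assms by (simp add: theta_prod_def mult.commute)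

text \<open>The functional equation of j, differentiated. The additional
  \<open>theta_prod p z\<close> comes from the factor 1/z; for the quotient it means that
  \<open>theta_zeta\<close> grows by 1 under z -> p z.\<close>

lemma theta_der_shift:
  assumes "z \<noteq> 0"
  shows "theta_der p (p * z) = - (theta_der p z + theta_prod p z) / z"
proof -
  have "qpoch z p = (1 - z) * qpoch (p * z) p"
    using qpoch_rec[OF p(1), of z] by (simp add: mult.commute)
  moreover have "qpoch (1 / z) p = (1 - 1 / z) * qpoch (p / z) p"
    using qpoch_rec[OF p(1), of "1 / z"] by simp
  moreover have "deriv (\<lambda>w. qpoch w p) (1 / z) =
      (1 - 1 / z) * p * deriv (\<lambda>w. qpoch w p) (p / z) - qpoch (p / z) p"
    using deriv_qpoch_rec[of "1 / z"] by simp
  moreover have "p / (p * z) = 1 / z"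
    using p(2) by simp
  ultimately show ?thesis
    using assms
    by (simp only: theta_prod_def theta_der_def deriv_qpoch_rec[of z]) (simp add: field_simps)
qed

lemma theta_der_inverse:
  assumes "z \<noteq> 0"
  shows "theta_der p (1 / z) = (theta_der p z + theta_prod p z) / z"
proof -
  have "theta_der p (1 / z) = - theta_der p (p * z)"
    using assms p(2) by (simp add: theta_der_def)
  thus ?thesis
    using theta_der_shift[OF assms] by (simp add: minus_divide_left)
qed

lemma theta_der_1: "theta_der p 1 = (qpoch p p)\<^sup>2"
  using qpoch_rec[OF p(1), of 1] deriv_qpoch_rec[of 1]
  by (simp add: theta_der_def power2_eq_square)

lemma theta_prod_1: "theta_prod p 1 = 0"
  using qpoch_rec[OF p(1), of 1] by (simp add: theta_prod_def)

lemma theta_prod_eq_0_iff: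
  assumes "z \<noteq> 0"
  shows "theta_prod p z = 0 \<longleftrightarrow> (\<exists>k::int. z = p powi k)"
proof
  assume "theta_prod p z = 0"
  then consider n where "z * p ^ n = 1" | n where "p / z * p ^ n = 1"
    by (auto simp: theta_prod_def qpoch_eq_0_iff[OF p(1)])
  thus "\<exists>k::int. z = p powi k"
  proof cases
    case 1
    hence "z = p powi (- int n)"
      using p(2) by (simp add: power_int_minus field_simps)
    thus ?thesis ..
  next
    case 2
    hence "z = p powi (int (Suc n))"
      using p(2) assms by (simp add: field_simps del: of_nat_Suc)
    thus ?thesis ..
  qed
next
  assume "\<exists>k::int. z = p powi k"
  then obtain k :: int where k: "z = p powi k" ..
  have "(theta_prod p (p powi k * 1) = 0) = (theta_prod p 1 = 0)"
    by (rule powi_periodic) (use p in \<open>auto simp: theta_prod_shift\<close>)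
  thus "theta_prod p z = 0"
    using k theta_prod_1 by simp
qed

text \<open>The zeros of j are simple: a shift reduces to z = 1, where the value is E(p)^2. The
  shift of \<open>theta_der\<close> involves \<open>theta_prod\<close>, so only the joint vanishing
  of both is periodic.\<close>

lemma theta_der_nonzero:
  assumes "z \<noteq> 0" "theta_prod p z = 0"
  shows "theta_der p z \<noteq> 0"
proof -
  obtain k :: int where k: "z = p powi k"
    using assms theta_prod_eq_0_iff by blast
  have "(theta_prod p (p powi k * 1) = 0 \<and> theta_der p (p powi k * 1) = 0) =
        (theta_prod p 1 = 0 \<and> theta_der p 1 = 0)"
    by (rule powi_periodic[where f = "\<lambda>z. theta_prod p z = 0 \<and> theta_der p z = 0"])
       (use p in \<open>auto simp: theta_prod_shift theta_der_shift\<close>)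
  moreover have "qpoch p p \<noteq> 0"
    using euler_E_nonzero[OF p(1)] by (simp add: euler_E_eq_qpoch)
  ultimately show ?thesis
    using assms k theta_prod_1 theta_der_1 by auto
qed

lemma theta_zeta_inverse:
  assumes "z \<noteq> 0" "theta_prod p z \<noteq> 0"
  shows "theta_zeta p (1 / z) = - theta_zeta p z - 1"
  unfolding theta_zeta_def theta_prod_inverse[OF assms(1)] theta_der_inverse[OF assms(1)]
  using assms by (simp add: field_simps)

lemma theta_prod_has_deriv:
  assumes "z \<noteq> 0"
  shows "(theta_prod p has_field_derivative (- theta_der p z / z)) (at z)"
  unfolding theta_prod_def[abs_def] theta_der_def
  by (rule derivative_eq_intros DERIV_chain2[OF qpoch_has_deriv] qpoch_has_deriv refl assms)+
     (use assms in \<open>simp add: field_simps\<close>)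

lemma holomorphic_theta_prod:
  assumes "f holomorphic_on S" "\<And>z. z \<in> S \<Longrightarrow> f z \<noteq> 0"
  shows "(\<lambda>z. theta_prod p (f z)) holomorphic_on S"
  unfolding theta_prod_def using assms p by (intro holomorphic_intros) auto

lemma holomorphic_theta_der:
  assumes "f holomorphic_on S" "\<And>z. z \<in> S \<Longrightarrow> f z \<noteq> 0"
  shows "(\<lambda>z. theta_der p (f z)) holomorphic_on S"
proof -
  have "deriv (\<lambda>w. qpoch w p) holomorphic_on UNIV"
    by (intro holomorphic_deriv holomorphic_intros p) auto
  note * = holomorphic_on_compose_gen[OF _ this, unfolded o_def]
  show ?thesis
    unfolding theta_der_def using assms p by (intro holomorphic_intros *) auto
qed

text \<open>
  The difference of both sides is an elliptic function of \<open>a\<close> whose poles cancel and which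
  vanishes at \<open>1 / b\<close>.
\<close>
theorem theta_zeta_addition:
  assumes nz: "a \<noteq> 0" "b \<noteq> 0" "c \<noteq> 0"
    and tnz: "theta_prod p a \<noteq> 0" "theta_prod p b \<noteq> 0" "theta_prod p c \<noteq> 0"
      "theta_prod p (a * b * c) \<noteq> 0" "theta_prod p (b * c) \<noteq> 0"
  shows "theta_zeta p a + theta_zeta p b + theta_zeta p c - theta_zeta p (a * b * c) + 1 =
    (qpoch p p)\<^sup>2 * theta_prod p (a * b) * theta_prod p (a * c) * theta_prod p (b * c) /
      (theta_prod p a * theta_prod p b * theta_prod p c * theta_prod p (a * b * c))"
proof -
  let ?j = "theta_prod p" and ?K = "theta_der p"
  \<comment> \<open>\<open>C\<close> and \<open>D\<close> collect what does not depend on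
    \<open>a\<close>. Then \<open>\<Phi>\<close> is the difference of the two sides, as a function
    of z in the place of \<open>a\<close>, multiplied by the denominator \<open>h\<close>.\<close>
  define C where "C = theta_zeta p b + theta_zeta p c + 1"
  define D where "D = (qpoch p p)\<^sup>2 * ?j (b * c) / (?j b * ?j c)"
  define h where "h = (\<lambda>z. ?j z * ?j (z * b * c))"
  define \<Phi> where "\<Phi> = (\<lambda>z. ?K z * ?j (z * b * c) - ?K (z * b * c) * ?j z + C * h z
                             - D * ?j (z * b) * ?j (z * c))"
  define \<Psi> where "\<Psi> = (\<lambda>z. \<Phi> z / h z)"
  \<comment> \<open>The extra terms from shifting the two values of \<open>theta_der\<close> cancel,
    so \<open>\<Phi>\<close> and \<open>h\<close> acquire the same factor and their quotient is
    invariant.\<close>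
  have shift: "\<Phi> (p * z) = \<Phi> z / (z\<^sup>2 * b * c)" "h (p * z) = h z / (z\<^sup>2 * b * c)" if "z \<noteq> 0" for z
  proof -
    have eqs: "?j (p * z) = - ?j z / z" "?K (p * z) = - (?K z + ?j z) / z"
      "?j (p * z * b) = - ?j (z * b) / (z * b)" "?j (p * z * c) = - ?j (z * c) / (z * c)"
      "?j (p * z * b * c) = - ?j (z * b * c) / (z * b * c)"
      "?K (p * z * b * c) = - (?K (z * b * c) + ?j (z * b * c)) / (z * b * c)"
      using theta_prod_shift theta_der_shift that nz by (simp_all add: mult.assoc)
    show "\<Phi> (p * z) = \<Phi> z / (z\<^sup>2 * b * c)" "h (p * z) = h z / (z\<^sup>2 * b * c)"
      unfolding \<Phi>_def h_def eqs using that nz by (simp_all add: power2_eq_square field_simps)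
  qed
  have per: "\<Psi> (p * z) = \<Psi> z" if "z \<noteq> 0" for z
    using that nz by (simp add: \<Psi>_def shift)
  have inv_bc: "?j (1 / (b * c)) = - ?j (b * c) / (b * c)"
    by (rule theta_prod_inverse) (use nz in auto)
  \<comment> \<open>Up to powers of \<open>p\<close>, the zeros of \<open>h\<close> are 1 and 1/(b
    c). The factor E(p)^2 in \<open>D\<close> is exactly what makes \<open>\<Phi>\<close> vanish
    there, through \<open>theta_der_1\<close>.\<close>
  have \<Phi>1: "\<Phi> 1 = 0"
    using tnz by (simp add: \<Phi>_def h_def D_def theta_prod_1 theta_der_1)
  have \<Phi>2: "\<Phi> (1 / (b * c)) = 0"
  proof -
    have "1 / (b * c) * b = 1 / c" "1 / (b * c) * c = 1 / b" "1 / (b * c) * b * c = 1"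
      using nz by auto
    thus ?thesis
      using tnz nz theta_prod_inverse[of b] theta_prod_inverse[of c] inv_bc
      by (simp add: \<Phi>_def h_def D_def theta_prod_1 theta_der_1)
  qed
  have \<Phi>3: "\<Phi> (1 / b) = 0"
    using tnz nz unfolding \<Phi>_def h_def C_def theta_prod_inverse[OF nz(2)] theta_der_inverse[OF nz(2)]
    by (simp add: theta_prod_1 theta_zeta_def field_simps)
  \<comment> \<open>The second conjunct is the derivative of \<open>h\<close>. It is nonzero because
    j has simple zeros and, as j(b c) is nonzero, the two families of zeros of \<open>h\<close> are
    disjoint. L'Hospital's rule then gives \<open>\<Psi>\<close> a finite limit.\<close>
  have zero: "\<Phi> z = 0 \<and> (- ?K z / z * ?j (z * b * c) - ?j z * ?K (z * b * c) / z) \<noteq> 0"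
    if z: "z \<noteq> 0" "h z = 0" for z
  proof -
    have \<Phi>z: "\<Phi> (p powi k * w) = 0 \<longleftrightarrow> \<Phi> w = 0" if "w \<noteq> 0" for k w
      by (rule powi_periodic[where f = "\<lambda>z. \<Phi> z = 0"]) (use p shift nz that in auto)
    have jz: "?j (p powi k * w) = 0 \<longleftrightarrow> ?j w = 0" if "w \<noteq> 0" for k w
      by (rule powi_periodic[where f = "\<lambda>z. ?j z = 0"]) (use p theta_prod_shift that in auto)
    consider "?j z = 0" | "?j (z * b * c) = 0"
      using z by (auto simp: h_def)
    thus ?thesis
    proof cases
      case 1
      then obtain k :: int where k: "z = p powi k"
        using z theta_prod_eq_0_iff by blast
      have "\<Phi> z = 0"
        using \<Phi>z[of 1 k] \<Phi>1 k by simp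
      moreover have "?j (z * b * c) \<noteq> 0"
        using jz[of "b * c" k] tnz nz k by (simp add: mult.assoc)
      ultimately show ?thesis
        using 1 theta_der_nonzero[OF z(1)] z(1) by simp
    next
      case 2
      then obtain k :: int where k: "z * b * c = p powi k"
        using z nz theta_prod_eq_0_iff[of "z * b * c"] by auto
      hence k: "z = p powi k * (1 / (b * c))"
        using nz by (simp add: field_simps)
      have "\<Phi> z = 0"
        using \<Phi>z[of "1 / (b * c)" k] \<Phi>2 k nz by simp
      moreover have "?j z \<noteq> 0"
        using jz[of "1 / (b * c)" k] tnz nz k inv_bc by simp
      ultimately show ?thesis
        using 2 theta_der_nonzero[of "z * b * c"] z(1) nz by simp
    qed
  qed
  have hol: "\<Phi> holomorphic_on - {0}" "h holomorphic_on - {0}"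
    unfolding \<Phi>_def h_def using nz
    by (auto intro!: holomorphic_intros holomorphic_theta_prod holomorphic_theta_der)
  have ana: "\<Phi> analytic_on {z}" "h analytic_on {z}" if "z \<noteq> 0" for z
    using hol that by (auto intro: holomorphic_on_imp_analytic_at)
  have lim: "\<exists>l. \<Psi> \<midarrow>z\<rightarrow> l" if z: "z \<noteq> 0" for z
  proof (cases "h z = 0")
    case False
    have "\<Psi> analytic_on {z}"
      unfolding \<Psi>_def using ana[OF z] False by (intro analytic_intros) auto
    thus ?thesis
      using analytic_at_imp_isCont isContD by blast
  next
    case True
    have "(h has_field_derivative (- ?K z / z * ?j (z * b * c) - ?j z * ?K (z * b * c) / z)) (at z)"
      unfolding h_def
      by (rule derivative_eq_intros DERIV_chain2[OF theta_prod_has_deriv] theta_prod_has_deriv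
            refl z | use nz z in simp)+
    moreover have "(\<Phi> has_field_derivative deriv \<Phi> z) (at z)"
      using holomorphic_derivI[OF hol(1)] z by auto
    ultimately show ?thesis
      unfolding \<Psi>_def using lhopital_complex_simple zero[OF z True] True by blast
  qed
  have iso: "isolated_singularity_at \<Psi> z" if "z \<noteq> 0" for z
    unfolding \<Psi>_def using ana[OF that]
    by (intro isolated_singularity_at_divide isolated_singularity_at_analytic not_essential_analytic)
  \<comment> \<open>At the zeros of \<open>h\<close> the quotient \<open>\<Psi>\<close> has the
    default value 0, not its limit, so Liouville's theorem is applied to the extension over the
    removable singularities.\<close>
  define R where "R = remove_sings \<Psi>"
  have "R analytic_on - {0}"
    unfolding R_def using remove_sings_analytic_at iso lim
    by (subst analytic_on_analytic_at) (metis ComplD singletonI)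
  hence R_hol: "R holomorphic_on - {0}"
    by (rule analytic_imp_holomorphic)
  have R_per: "R (p * z) = R z" if z: "z \<noteq> 0" for z
  proof -
    obtain l where l: "\<Psi> \<midarrow>z\<rightarrow> l"
      using lim z by blast
    have "filterlim (\<lambda>w. w / p) (at z) (at (p * z))"
    proof (rule filterlim_atI)
      show "((\<lambda>w. w / p) \<longlongrightarrow> z) (at (p * z))"
        using p by (auto intro!: tendsto_eq_intros)
      show "\<forall>\<^sub>F w in at (p * z). w / p \<noteq> z"
        using p by (auto simp: eventually_at_filter field_simps)
    qed
    from filterlim_compose[OF l this] have "(\<lambda>w. \<Psi> (w / p)) \<midarrow>p * z\<rightarrow> l" .
    moreover have "\<forall>\<^sub>F w in at (p * z). \<Psi> (w / p) = \<Psi> w"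
    proof -
      have "\<forall>\<^sub>F w in at (p * z). w \<noteq> 0"
        using z p by (intro eventually_neq_at_within)
      thus ?thesis
        by eventually_elim (metis divide_eq_0_iff nonzero_mult_div_cancel_left p(2) per times_divide_eq_right)
    qed
    ultimately have "\<Psi> \<midarrow>p * z\<rightarrow> l"
      by (rule Lim_transform_eventually)
    thus ?thesis
      using l by (simp add: R_def remove_sings_eqI)
  qed
  have R_eq: "R z = \<Psi> z" if "z \<noteq> 0" "h z \<noteq> 0" for z
    unfolding R_def \<Psi>_def using ana[OF that(1)] that
    by (intro remove_sings_at_analytic analytic_intros) auto
  have "h (1 / b) \<noteq> 0"
    using nz tnz theta_prod_inverse[of b] by (simp add: h_def)
  hence "R (1 / b) = 0"
    using R_eq \<Phi>3 nz by (simp add: \<Psi>_def)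
  moreover have "R a = R (1 / b)"
    by (rule periodic_holomorphic_constant[OF p R_hol]) (use R_per nz in auto)
  moreover have "h a \<noteq> 0"
    using tnz by (simp add: h_def)
  ultimately have "\<Phi> a / h a = 0"
    using R_eq nz by (simp add: \<Psi>_def)
  moreover have "\<Phi> a / h a = theta_zeta p a - theta_zeta p (a * b * c) + C
      - D * ?j (a * b) * ?j (a * c) / (?j a * ?j (a * b * c))"
    using tnz by (simp add: \<Phi>_def h_def theta_zeta_def diff_divide_distrib add_divide_distrib)
  moreover have "D * ?j (a * b) * ?j (a * c) / (?j a * ?j (a * b * c)) =
      (qpoch p p)\<^sup>2 * ?j (a * b) * ?j (a * c) * ?j (b * c) / (?j a * ?j b * ?j c * ?j (a * b * c))"
    by (simp add: D_def mult_ac)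
  ultimately show ?thesis
    by (simp add: C_def algebra_simps)
qed

end

section \<open>The characters of conductor 5 and 15\<close>

text \<open>A completely multiplicative function on the positive integers is determined by its
  values at primes.\<close>

lemma kronecker_eqI:
  fixes chi :: "int \<Rightarrow> int"
  assumes "chi 1 = 1" "\<And>m n. chi (m * n) = chi m * chi n"
    and "\<And>p. prime p \<Longrightarrow> kronecker_prime a p = chi p" and "n > 0"
  shows "kronecker a n = chi n"
proof -
  have pow: "chi (x ^ k) = chi x ^ k" for x k
    by (induction k) (simp_all add: assms)
  have pr: "chi (prod f A) = (\<Prod>x\<in>A. chi (f x))" if "finite A" for f and A :: "int set"
    using that by (induction rule: finite_induct) (simp_all add: assms)
  have "n = (\<Prod>p\<in>prime_factors n. p ^ multiplicity p n)"
    using prime_factorization_int[OF assms(4)] by simp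
  hence "chi n = chi (\<Prod>p\<in>prime_factors n. p ^ multiplicity p n)"
    by simp
  also have "\<dots> = (\<Prod>p\<in>prime_factors n. kronecker_prime a p ^ multiplicity p n)"
    by (simp add: pr pow assms(3) in_prime_factors_imp_prime)
  finally show ?thesis
    using assms(4) by (simp add: kronecker_def)
qed

text \<open>Euler's criterion determines the symbol modulo p, and -1, 0, 1 are pairwise incongruent
  modulo p > 2.\<close>

lemma Legendre_eqI:
  fixes p :: nat
  assumes "prime p" "2 < p" "[a ^ ((p - 1) div 2) = x] (mod int p)" "x \<in> {- 1, 0, 1}"
  shows "Legendre a (int p) = x"
proof -
  have "[Legendre a (int p) = x] (mod int p)"
    using euler_criterion[OF assms(1,2)] assms(3) cong_trans by blast
  hence d: "int p dvd Legendre a (int p) - x"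
    by (simp add: cong_iff_dvd_diff)
  have "\<bar>Legendre a (int p) - x\<bar> \<le> 2"
    using assms(4) by (auto simp: Legendre_def)
  with d assms(2) have "Legendre a (int p) - x = 0"
    using zdvd_not_zless[of "\<bar>Legendre a (int p) - x\<bar>" "int p"] by fastforce
  thus ?thesis by simp
qed

lemma Legendre_mult:
  fixes p :: nat
  assumes "prime p" "2 < p"
  shows "Legendre (a * b) (int p) = Legendre a (int p) * Legendre b (int p)"
proof (rule Legendre_eqI[OF assms])
  show "[(a * b) ^ ((p - 1) div 2) = Legendre a (int p) * Legendre b (int p)] (mod int p)"
    unfolding power_mult_distrib
    by (intro cong_mult cong_sym[OF euler_criterion] assms)
qed (auto simp: Legendre_def)

definition char3 :: "int \<Rightarrow> int" where
  "char3 n = (if n mod 3 = 1 then 1 else if n mod 3 = 2 then - 1 else 0)"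

definition char5 :: "int \<Rightarrow> int" where
  "char5 n = (if n mod 5 \<in> {1, 4} then 1 else if n mod 5 = 0 then 0 else - 1)"

lemma char3_mult: "char3 (m * n) = char3 m * char3 n"
proof -
  have mod: "char3 (x mod 3) = char3 x" for x
    by (simp add: char3_def)
  have "m mod 3 = 0 \<or> m mod 3 = 1 \<or> m mod 3 = 2" "n mod 3 = 0 \<or> n mod 3 = 1 \<or> n mod 3 = 2"
    by presburger+
  hence "char3 ((m mod 3) * (n mod 3)) = char3 (m mod 3) * char3 (n mod 3)"
    by (elim disjE) (simp_all add: char3_def)
  thus ?thesis
    by (metis mod mod_mult_eq)
qed

lemma char5_mult: "char5 (m * n) = char5 m * char5 n"
proof -
  have mod: "char5 (x mod 5) = char5 x" for x
    by (simp add: char5_def)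
  have "x mod 5 = 0 \<or> x mod 5 = 1 \<or> x mod 5 = 2 \<or> x mod 5 = 3 \<or> x mod 5 = 4" for x :: int
    by presburger
  from this[of m] this[of n]
  have "char5 ((m mod 5) * (n mod 5)) = char5 (m mod 5) * char5 (n mod 5)"
    by (elim disjE) (simp_all add: char5_def)
  thus ?thesis
    by (metis mod mod_mult_eq)
qed

lemma Legendre_mod_3: "Legendre n 3 = char3 n"
proof -
  have "n mod 3 = 0 \<or> n mod 3 = 1 \<or> n mod 3 = 2"
    by presburger
  hence "[n = char3 n] (mod 3)"
    by (elim disjE) (simp_all add: char3_def cong_def)
  thus ?thesis
    using Legendre_eqI[of 3 n "char3 n"] by (auto simp: char3_def)
qed

lemma Legendre_mod_5: "Legendre n 5 = char5 n"
proof -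
  have "n mod 5 = 0 \<or> n mod 5 = 1 \<or> n mod 5 = 2 \<or> n mod 5 = 3 \<or> n mod 5 = 4"
    by presburger
  hence "(n mod 5) ^ 2 mod 5 = char5 n mod 5"
    by (elim disjE) (simp_all add: char5_def)
  hence "[n ^ 2 = char5 n] (mod 5)"
    by (simp add: cong_def power_mod)
  thus ?thesis
    using Legendre_eqI[of 5 n "char5 n"] by (auto simp: char5_def)
qed

lemma Legendre_self: "Legendre (int p) (int p) = 0"
  by (simp add: Legendre_def cong_0_iff)

lemma Legendre_5:
  fixes p :: nat
  assumes "prime p" "2 < p"
  shows "Legendre 5 (int p) = char5 (int p)"
proof (cases "p = 5")
  case True
  thus ?thesis using Legendre_self[of 5] by (simp add: char5_def)
next
  case False
  have "Legendre (int 5) (int p) * Legendre (int p) (int 5) = 1"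
    using Quadratic_Reciprocity[of 5 p] False assms by (simp add: power_mult)
  thus ?thesis
    by (auto simp: Legendre_mod_5) (auto simp: Legendre_def char5_def split: if_splits)
qed

text \<open>Reciprocity for 3 leaves the sign (-1)^((p-1)/2), which is also the symbol of -1. The
  two cancel, so it is -3 that belongs to a character modulo 3.\<close>

lemma Legendre_minus_3:
  fixes p :: nat
  assumes "prime p" "2 < p"
  shows "Legendre (- 3) (int p) = char3 (int p)"
proof (cases "p = 3")
  case True
  thus ?thesis by (simp add: Legendre_mod_3 char3_def)
next
  case False
  have 1: "Legendre (int 3) (int p) * Legendre (int p) (int 3) = (- 1) ^ ((p - 1) div 2)"
    using Quadratic_Reciprocity[of 3 p] False assms by simp
  have 2: "Legendre (- 1) (int p) = (- 1) ^ ((p - 1) div 2)"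
    by (rule Legendre_eqI[OF assms]) (auto simp: minus_one_power_iff)
  have "Legendre (- 3) (int p) = Legendre (- 1) (int p) * Legendre 3 (int p)"
    using Legendre_mult[OF assms, of "- 1" 3] by simp
  thus ?thesis
    using 1 2 by (auto simp: Legendre_mod_3)
      (auto simp: Legendre_def char3_def minus_one_power_iff split: if_splits)
qed

lemma prime_int_cases:
  assumes "prime (p::int)"
  obtains "p = 2" | n where "p = int n" "prime n" "n > 2"
proof -
  have "p = int (nat p)" "prime (nat p)"
    using assms prime_gt_0_int[of p] by (auto simp: prime_nat_iff_prime)
  thus thesis
    using that prime_ge_2_nat[of "nat p"] by (metis le_neq_implies_less of_nat_numeral)
qed

lemma kronecker_5:
  assumes "n > 0"
  shows "kronecker 5 n = char5 n"
proof (rule kronecker_eqI)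
  fix p :: int assume "prime p"
  thus "kronecker_prime 5 p = char5 p"
    by (cases rule: prime_int_cases) (auto simp: kronecker_prime_def Legendre_5 char5_def)
qed (use assms in \<open>auto simp: char5_mult\<close>, simp add: char5_def)

lemma kronecker_minus_15:
  assumes "n > 0"
  shows "kronecker (- 15) n = char3 n * char5 n"
proof (rule kronecker_eqI[where chi = "\<lambda>n. char3 n * char5 n"])
  fix p :: int assume "prime p"
  thus "kronecker_prime (- 15) p = char3 p * char5 p"
  proof (cases rule: prime_int_cases)
    case (2 n)
    have "Legendre (- 15) (int n) = Legendre (- 3) (int n) * Legendre 5 (int n)"
      using Legendre_mult[of n "- 3" 5] 2 by simp
    with 2 show ?thesis
      by (simp add: kronecker_prime_def Legendre_5 Legendre_minus_3)
  qed (simp add: kronecker_prime_def char3_def char5_def)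
qed (use assms in \<open>auto simp: char5_mult char3_mult\<close>, simp add: char3_def char5_def)

section \<open>The Lambert series of P and Q\<close>

lemma suminf_split_residues:
  fixes f :: "nat \<Rightarrow> 'a::real_normed_vector"
  assumes "summable f" "m > 0" "\<And>r. r < m \<Longrightarrow> (\<lambda>k. f (r + m * k)) sums S r"
  shows "suminf f = (\<Sum>r<m. S r)"
proof -
  have "(\<lambda>k. sum f {k * m..<k * m + m}) sums suminf f"
    by (rule sums_group) (use assms summable_sums in auto)
  also have "(\<lambda>k. sum f {k * m..<k * m + m}) = (\<lambda>k. \<Sum>r<m. f (r + m * k))"
  proof
    fix k show "sum f {k * m..<k * m + m} = (\<Sum>r<m. f (r + m * k))"
      using sum.shift_bounds_nat_ivl[of f 0 "k * m" m]
      by (simp add: lessThan_atLeast0 add.commute mult.commute)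
  qed
  finally show ?thesis
    using sums_sum[of "{..<m}" "\<lambda>r k. f (r + m * k)" S] assms(3) sums_unique2 by blast
qed

lemma lambert_sums:
  assumes "norm p < 1" "norm z < 1"
  shows "(\<lambda>n. z * p ^ n / (1 - z * p ^ n)) sums lambert p z"
  unfolding lambert_def
  using logderiv_qpoch[OF assms(1) qpoch_nonzero[OF assms]] by (rule summable_sums[OF sums_summable])

lemma prod_lessThan_numeral:
  fixes f :: "nat \<Rightarrow> 'a::comm_monoid_mult"
  shows "(\<Prod>r<3. f r) = f 0 * f 1 * f 2"
    and "(\<Prod>r<5. f r) = f 0 * f 1 * f 2 * f 3 * f 4"
    and "(\<Prod>r<15. f r) = f 0 * f 1 * f 2 * f 3 * f 4 * f 5 * f 6 * f 7 *
           f 8 * f 9 * f 10 * f 11 * f 12 * f 13 * f 14"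
  by (simp_all add: eval_nat_numeral mult_ac)

locale punctured_disc =
  fixes q :: complex
  assumes q: "norm q < 1" "q \<noteq> 0"
begin

lemma norm_power_less_1: "s > 0 \<Longrightarrow> norm (q ^ s) < 1"
  using q by (simp add: norm_power power_less_one_iff)

lemma norm_power_less_norm_power: "r < s \<Longrightarrow> norm (q ^ s) < norm (q ^ r)"
  using q by (simp add: norm_power power_strict_decreasing)

lemma euler_E_nz: "s > 0 \<Longrightarrow> euler_E (q ^ s) \<noteq> 0"
  by (intro euler_E_nonzero norm_power_less_1)

lemma qpoch_split_power:
  assumes "d > 0" "m > 0"
  shows "qpoch (w * q ^ d) (q ^ d) = (\<Prod>r<m. qpoch (w * q ^ (d * Suc r)) (q ^ (d * m)))"
  by (subst qpoch_split[OF norm_power_less_1[OF assms(1)] assms(2)])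
     (simp add: power_add power_mult mult.assoc)

text \<open>The character is 1 at 1, 2, 4, 8 and -1 at 14, 13, 11, 7. The arguments -q, -q^2, -q^4
  account for three of the pairs {s, 15 - s}. Their product -q^7 accounts for the fourth, and it
  enters the addition formula with the minus sign that the character has at 7.\<close>

lemma P_quotient_eq_lambert:
  "P_quotient q =
     1 - (\<Sum>n. of_int (kronecker (- 15) (int (Suc n))) * (q ^ Suc n / (1 + q ^ Suc n)))"
proof -
  define p where "p = q ^ 15"
  define f :: "nat \<Rightarrow> complex" where
    "f = (\<lambda>n. of_int (kronecker (- 15) (int (Suc n))) * (q ^ Suc n / (1 + q ^ Suc n)))"
  define G where "G = (\<lambda>s::nat. qpoch (- (q ^ s)) p)"
  define H where "H = (\<lambda>s::nat. qpoch (q ^ s) p)"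
  define L where "L = (\<lambda>s::nat. lambert p (- (q ^ s)))"
  have p: "norm p < 1" "p \<noteq> 0"
    using norm_power_less_1[of 15] q by (auto simp: p_def)
  have GH: "G s \<noteq> 0" "H s \<noteq> 0" if "s > 0" for s
    using norm_power_less_1[OF that] p by (simp_all add: G_def H_def qpoch_nonzero)
  have "suminf f = (\<Sum>r<15. - of_int (char3 (int (Suc r)) * char5 (int (Suc r))) * L (Suc r))"
  proof (rule suminf_split_residues)
    show "summable f"
      unfolding f_def by (rule summable_kronecker_P[OF q(1)])
    fix r :: nat
    let ?c = "of_int (char3 (int (Suc r)) * char5 (int (Suc r))) :: complex"
    have kron: "kronecker (- 15) (int (Suc (r + 15 * k))) =
            char3 (int (Suc r)) * char5 (int (Suc r))" for k
    proof -
      have "int (Suc (r + 15 * k)) mod 3 = int (Suc r) mod 3"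
           "int (Suc (r + 15 * k)) mod 5 = int (Suc r) mod 5"
        by presburger+
      thus ?thesis
        by (simp only: kronecker_minus_15 char3_def char5_def of_nat_0_less_iff zero_less_Suc)
    qed
    have pow: "q ^ Suc (r + 15 * k) = q ^ Suc r * p ^ k" for k
      by (simp only: p_def power_mult[symmetric] power_add[symmetric] add_Suc)
    \<comment> \<open>x/(1 + x) is minus the Lambert term at -x, which absorbs the minus sign in
      front of the series.\<close>
    have f: "f (r + 15 * k) = - ?c * (- (q ^ Suc r) * p ^ k / (1 - (- (q ^ Suc r)) * p ^ k))" for k
      by (simp only: f_def kron pow) simp
    have "(\<lambda>k. - (q ^ Suc r) * p ^ k / (1 - (- (q ^ Suc r)) * p ^ k)) sums L (Suc r)"
      unfolding L_def using norm_power_less_1[of "Suc r"] p by (intro lambert_sums) auto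
    from sums_mult[OF this, of "- ?c"] show "(\<lambda>k. f (r + 15 * k)) sums (- ?c * L (Suc r))"
      by (simp only: f)
  qed auto
  hence sum: "1 - suminf f = 1 + L 1 + L 2 + L 4 + L 8 - L 7 - L 11 - L 13 - L 14"
    by (simp add: lessThan_Suc numeral_eq_Suc char3_def char5_def)
  have quot: "p / - (q ^ s) = - (q ^ (15 - s))" "p / q ^ s = q ^ (15 - s)" if "s \<le> 15" for s
    using q that by (simp_all add: p_def power_diff)
  have nz: "theta_prod p (- (q ^ s)) \<noteq> 0" "theta_prod p (q ^ s) \<noteq> 0" if "0 < s" "s < 15" for s
    using that norm_power_less_1[of s] norm_power_less_norm_power[of s 15]
    by (simp_all add: p_def theta_prod_nonzero)
  have prods: "theta_prod p (- (q ^ s)) = G s * G (15 - s)" "theta_prod p (q ^ s) = H s * H (15 - s)"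
    if "s \<le> 15" for s
    using quot[OF that] by (simp_all add: theta_prod_def G_def H_def)
  have zeta: "theta_zeta p (- (q ^ s)) = L s - L (15 - s)" if "0 < s" "s < 15" for s
    using theta_zeta_eq_lambert[OF p nz(1)[OF that]] quot[of s] that by (simp add: L_def)
  have pw: "- q * - (q ^ 2) = q ^ 3" "- q * - (q ^ 4) = q ^ 5" "- (q ^ 2) * - (q ^ 4) = q ^ 6"
      "- q * - (q ^ 2) * - (q ^ 4) = - (q ^ 7)"
    by (simp_all add: eval_nat_numeral)
  have "1 - suminf f = theta_zeta p (- q) + theta_zeta p (- (q ^ 2)) + theta_zeta p (- (q ^ 4))
          - theta_zeta p (- (q ^ 7)) + 1"
    using zeta[of 1] zeta[of 2] zeta[of 4] zeta[of 7] by (simp add: sum)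
  also have "\<dots> =
        (qpoch p p)\<^sup>2 * theta_prod p (q ^ 3) * theta_prod p (q ^ 5) * theta_prod p (q ^ 6) /
        (theta_prod p (- q) * theta_prod p (- (q ^ 2)) * theta_prod p (- (q ^ 4)) *
         theta_prod p (- (q ^ 7)))"
    using theta_zeta_addition[OF p, of "- q" "- (q ^ 2)" "- (q ^ 4)"] nz[of 1] nz[of 2] nz[of 4]
      nz[of 6] nz[of 7] q unfolding pw by simp
  also have "\<dots> = (H 15)\<^sup>2 * (H 3 * H 12) * (H 5 * H 10) * (H 6 * H 9) /
        (G 1 * G 14 * (G 2 * G 13) * (G 4 * G 11) * (G 7 * G 8))"
    using prods[of 1] prods[of 2] prods[of 3] prods[of 4] prods[of 5] prods[of 6] prods[of 7]
    by (simp add: H_def p_def)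
  finally have 1: "1 - suminf f = \<dots>" .
  \<comment> \<open>The numerator contains \<open>H 15\<close> twice: one copy completes the
    multiples of 3, the other the multiples of 5.\<close>
  have E3: "euler_E (q ^ 3) = H 3 * H 6 * H 9 * H 12 * H 15"
    and E5: "euler_E (q ^ 5) = H 5 * H 10 * H 15"
    using qpoch_split_power[of 3 5 1] qpoch_split_power[of 5 3 1]
    by (simp_all add: euler_E_eq_qpoch H_def p_def prod_lessThan_numeral)
  have G1: "G 1 * G 2 * G 3 * G 4 * G 5 * G 6 * G 7 * G 8 * G 9 * G 10 * G 11 * G 12 * G 13
      * G 14 * G 15 = euler_E (q ^ 2) / euler_E q"
    using qpoch_split_power[of 1 15 "- 1"] qpoch_uminus_self[of q] q
    by (simp add: G_def p_def prod_lessThan_numeral numeral_2_eq_2[symmetric] del: power_Suc)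
  have G3: "G 3 * G 6 * G 9 * G 12 * G 15 = euler_E (q ^ 6) / euler_E (q ^ 3)"
    using qpoch_split_power[of 3 5 "- 1"] qpoch_uminus_self[of "q ^ 3"] norm_power_less_1[of 3]
    by (simp add: G_def p_def prod_lessThan_numeral flip: power_mult)
  have G5: "G 5 * G 10 * G 15 = euler_E (q ^ 10) / euler_E (q ^ 5)"
    using qpoch_split_power[of 5 3 "- 1"] qpoch_uminus_self[of "q ^ 5"] norm_power_less_1[of 5]
    by (simp add: G_def p_def prod_lessThan_numeral flip: power_mult)
  have G15: "G 15 = euler_E (q ^ 30) / euler_E (q ^ 15)"
    using qpoch_uminus_self[of "q ^ 15"] norm_power_less_1[of 15]
    by (simp add: G_def p_def flip: power_mult)
  have "1 - suminf f = euler_E (q ^ 3) * euler_E (q ^ 5) /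
      (G 1 * G 14 * (G 2 * G 13) * (G 4 * G 11) * (G 7 * G 8))"
    unfolding 1 E3 E5 by (simp add: power2_eq_square mult_ac)
  \<comment> \<open>The indices on the left are the residues prime to 15. Inclusion-exclusion over 3
    and 5 expresses their product through all residues and the multiples of 3, of 5 and of
    15.\<close>
  also have "G 1 * G 14 * (G 2 * G 13) * (G 4 * G 11) * (G 7 * G 8) =
      (euler_E (q ^ 2) / euler_E q) * (euler_E (q ^ 30) / euler_E (q ^ 15)) /
      ((euler_E (q ^ 6) / euler_E (q ^ 3)) * (euler_E (q ^ 10) / euler_E (q ^ 5)))"
    unfolding G1[symmetric] G3[symmetric] G5[symmetric] G15[symmetric] using GH
    by (simp add: field_simps)
  finally have "P_quotient q = 1 - suminf f"
    using euler_E_nz euler_E_nz[of 1] by (simp add: P_quotient_def field_simps)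
  thus ?thesis
    by (simp only: f_def)
qed

text \<open>Partial fractions and the four residues prime to 5 give eight Lambert series. Each of
  the four \<open>theta_zeta\<close> values supplies two, one for \<alpha> and one for \<beta>, with
  exponents adding up to 5.\<close>

lemma Q_quotient_eq_lambert:
  "Q_quotient q =
     (\<Sum>n. of_int (kronecker 5 (int (Suc n))) *
           (q ^ Suc n * (1 + q ^ Suc n) / (1 + q ^ (3 * Suc n))))"
proof -
  define p where "p = q ^ 5"
  define f :: "nat \<Rightarrow> complex" where
    "f = (\<lambda>n. of_int (kronecker 5 (int (Suc n))) *
           (q ^ Suc n * (1 + q ^ Suc n) / (1 + q ^ (3 * Suc n))))"
  define \<alpha> where "\<alpha> = Complex (1 / 2) (sqrt 3 / 2)"
  define \<beta> where "\<beta> = Complex (1 / 2) (- sqrt 3 / 2)"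
  have \<alpha>\<beta>: "\<alpha> + \<beta> = 1" "\<alpha> * \<beta> = 1" "\<alpha> \<noteq> \<beta>"
    by (auto simp: \<alpha>_def \<beta>_def complex_eq_iff)
  have norm\<alpha>\<beta>: "norm \<alpha> = 1" "norm \<beta> = 1"
    by (simp_all add: \<alpha>_def \<beta>_def cmod_def power_divide)
  have \<alpha>\<beta>0: "\<alpha> \<noteq> 0" "\<beta> \<noteq> 0"
    using \<alpha>\<beta> by auto
  have inv: "1 / \<alpha> = \<beta>" "1 / \<beta> = \<alpha>"
    using \<alpha>\<beta> \<alpha>\<beta>0 by (simp_all add: field_simps)
  define G where "G = (\<lambda>s::nat. qpoch (- (q ^ s)) p)"
  define G3 where "G3 = (\<lambda>s::nat. qpoch (- (q ^ (3 * s))) (p ^ 3))"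
  define H where "H = (\<lambda>s::nat. qpoch (q ^ s) p)"
  define L where "L = (\<lambda>w (s::nat). lambert p (w * q ^ s))"
  have p: "norm p < 1" "p \<noteq> 0"
    using norm_power_less_1[of 5] q by (auto simp: p_def)
  have p3: "norm (p ^ 3) < 1"
    using norm_power_less_1[of 15] by (simp add: p_def flip: power_mult)
  have GH: "G s \<noteq> 0" "H s \<noteq> 0" "G3 s \<noteq> 0" if "s > 0" for s
    using norm_power_less_1[OF that] norm_power_less_1[of "3 * s"] that p p3
    by (simp_all add: G_def H_def G3_def qpoch_nonzero)
  \<comment> \<open>Cancelling 1 + x leaves x/(1 - x + x^2), whose denominator is (1 - \<alpha> x)(1
    - \<beta> x).\<close>
  have partial: "x * (1 + x) / (1 + x ^ 3) = (\<alpha> * x / (1 - \<alpha> * x) - \<beta> * x / (1 - \<beta> * x)) / (\<alpha> - \<beta>)"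
    if "norm x < 1" for x
  proof -
    have "w * x \<noteq> 1" if "norm w = 1" for w
      using \<open>norm x < 1\<close> that by (metis norm_mult norm_one mult_1 less_irrefl)
    hence nz: "1 + x \<noteq> 0" "1 - \<alpha> * x \<noteq> 0" "1 - \<beta> * x \<noteq> 0"
      using norm\<alpha>\<beta> one_plus_power_nonzero(2)[OF that, of 1] by auto
    have "(1 - \<alpha> * x) * (1 - \<beta> * x) = 1 - (\<alpha> + \<beta>) * x + \<alpha> * \<beta> * x\<^sup>2"
      by (simp add: algebra_simps power2_eq_square)
    hence d: "(1 - \<alpha> * x) * (1 - \<beta> * x) = 1 - x + x\<^sup>2"
      using \<alpha>\<beta> by simp
    have "(\<alpha> * x / (1 - \<alpha> * x) - \<beta> * x / (1 - \<beta> * x)) / (\<alpha> - \<beta>) =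
        x / ((1 - \<alpha> * x) * (1 - \<beta> * x))"
      using nz \<alpha>\<beta> by (simp add: divide_simps) (simp add: algebra_simps)
    also have "\<dots> = x * (1 + x) / ((1 - x + x\<^sup>2) * (1 + x))"
      unfolding d using nz by simp
    also have "(1 - x + x\<^sup>2) * (1 + x) = 1 + x ^ 3"
      by (simp add: algebra_simps power2_eq_square power3_eq_cube)
    finally show ?thesis ..
  qed
  have "suminf f = (\<Sum>r<5. of_int (char5 (int (Suc r))) * ((L \<alpha> (Suc r) - L \<beta> (Suc r)) / (\<alpha> - \<beta>)))"
  proof (rule suminf_split_residues)
    show "summable f"
      unfolding f_def by (rule summable_kronecker_Q[OF q(1)])
    fix r :: nat
    let ?c = "of_int (char5 (int (Suc r))) :: complex" and ?x = "q ^ Suc r"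
    have kron: "kronecker 5 (int (Suc (r + 5 * k))) = char5 (int (Suc r))" for k
    proof -
      have "int (Suc (r + 5 * k)) mod 5 = int (Suc r) mod 5"
        by presburger
      thus ?thesis
        by (simp only: kronecker_5 char5_def of_nat_0_less_iff zero_less_Suc)
    qed
    have pow: "q ^ Suc (r + 5 * k) = ?x * p ^ k" for k
      by (simp only: p_def power_mult[symmetric] power_add[symmetric] add_Suc)
    have pow3: "q ^ (3 * Suc (r + 5 * k)) = (?x * p ^ k) ^ 3" for k
      by (simp only: pow[symmetric] power_mult[symmetric] mult.commute[of 3])
    have f: "f (r + 5 * k) = ?c * ((\<alpha> * ?x * p ^ k / (1 - \<alpha> * ?x * p ^ k) -
          \<beta> * ?x * p ^ k / (1 - \<beta> * ?x * p ^ k)) / (\<alpha> - \<beta>))" for k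
      using partial[of "?x * p ^ k"] norm_power_less_1[of "Suc (r + 5 * k)"]
      by (simp only: f_def kron pow3) (simp only: pow mult.assoc zero_less_Suc)
    have "(\<lambda>k. w * ?x * p ^ k / (1 - w * ?x * p ^ k)) sums L w (Suc r)"
      if "norm w = 1" for w
      unfolding L_def using norm_power_less_1[of "Suc r"] p that
      by (intro lambert_sums) (simp_all only: norm_mult mult_1)
    from sums_mult[OF sums_divide[OF sums_diff[OF this[OF norm\<alpha>\<beta>(1)] this[OF norm\<alpha>\<beta>(2)]]]]
    show "(\<lambda>k. f (r + 5 * k)) sums (?c * ((L \<alpha> (Suc r) - L \<beta> (Suc r)) / (\<alpha> - \<beta>)))"
      by (simp only: f)
  qed auto
  hence "suminf f = (\<Sum>r<5. of_int (char5 (int (Suc r))) * (L \<alpha> (Suc r) - L \<beta> (Suc r))) / (\<alpha> - \<beta>)"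
    by (simp add: sum_divide_distrib)
  hence "(\<alpha> - \<beta>) * suminf f = (\<Sum>r<5. of_int (char5 (int (Suc r))) * (L \<alpha> (Suc r) - L \<beta> (Suc r)))"
    using \<alpha>\<beta>(3) by simp
  hence sum: "(\<alpha> - \<beta>) * suminf f = L \<alpha> 1 - L \<beta> 1 - L \<alpha> 2 + L \<beta> 2 - L \<alpha> 3 + L \<beta> 3 + L \<alpha> 4 - L \<beta> 4"
    by (simp add: lessThan_Suc numeral_eq_Suc char5_def)
  have quot: "p / (\<alpha> * q ^ s) = \<beta> * q ^ (5 - s)" "p / (\<beta> * q ^ s) = \<alpha> * q ^ (5 - s)"
      "p / q ^ s = q ^ (5 - s)" if "s \<le> 5" for s
  proof -
    have "p = q ^ s * q ^ (5 - s)"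
      using that by (simp add: p_def flip: power_add)
    moreover have "inverse \<alpha> = \<beta>" "inverse \<beta> = \<alpha>"
      using inv by (simp_all add: divide_inverse)
    ultimately show "p / (\<alpha> * q ^ s) = \<beta> * q ^ (5 - s)" "p / (\<beta> * q ^ s) = \<alpha> * q ^ (5 - s)"
        "p / q ^ s = q ^ (5 - s)"
      using q by (simp_all add: divide_inverse)
  qed
  have nz: "theta_prod p (w * q ^ s) \<noteq> 0" if "0 < s" "s < 5" "norm w = 1" for s w
    using that norm_power_less_1[of s] norm_power_less_norm_power[of s 5]
    by (intro theta_prod_nonzero) (simp_all add: p_def norm_mult)
  have zeta: "theta_zeta p (\<alpha> * q ^ s) = L \<alpha> s - L \<beta> (5 - s)"
      "theta_zeta p (\<beta> * q ^ s) = L \<beta> s - L \<alpha> (5 - s)" if "0 < s" "s < 5" for s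
    using theta_zeta_eq_lambert[OF p nz] quot[of s] that norm\<alpha>\<beta> by (simp_all add: L_def)
  \<comment> \<open>|\<alpha>/q| exceeds 1, outside the range of \<open>nz\<close> and
    \<open>zeta\<close>; inversion leads back to \<beta> q and produces the -1 that cancels the
    constant of the addition formula.\<close>
  have \<alpha>q: "\<alpha> / q = 1 / (\<beta> * q)"
    using inv(2) by (simp flip: divide_divide_eq_left)
  have zeta': "theta_zeta p (\<alpha> / q) = L \<alpha> 4 - L \<beta> 1 - 1"
    using theta_zeta_inverse[OF p, of "\<beta> * q"] zeta(2)[of 1] nz[of 1 \<beta>] norm\<alpha>\<beta> \<alpha>\<beta>0 q
    by (simp add: \<alpha>q)
  have prod': "theta_prod p (\<alpha> / q) = - theta_prod p (\<beta> * q) / (\<beta> * q)"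
    using theta_prod_inverse[OF p, of "\<beta> * q"] \<alpha>\<beta>0 q by (simp add: \<alpha>q)
  have pw: "\<alpha> * q * (\<beta> * q ^ 2) = q ^ 3" "\<alpha> * q * (\<alpha> / q) = - \<beta>" "\<beta> * q ^ 2 * (\<alpha> / q) = q"
      "q ^ 3 * (\<alpha> / q) = \<alpha> * q ^ 2"
  proof -
    have "\<alpha> * \<alpha> = \<alpha> * (1 - \<beta>)" using \<alpha>\<beta>(1) by (simp add: eq_diff_eq)
    also have "\<dots> = - \<beta>" using \<alpha>\<beta> by (simp add: algebra_simps)
    finally show "\<alpha> * q * (\<alpha> / q) = - \<beta>" using q by simp
    have "\<alpha> * q * (\<beta> * q ^ 2) = (\<alpha> * \<beta>) * q ^ 3"
      by (simp add: eval_nat_numeral)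
    thus "\<alpha> * q * (\<beta> * q ^ 2) = q ^ 3" using \<alpha>\<beta> by simp
    have "\<beta> * q ^ 2 * (\<alpha> / q) = (\<alpha> * \<beta>) * q"
      using q by (simp add: power2_eq_square)
    thus "\<beta> * q ^ 2 * (\<alpha> / q) = q" using \<alpha>\<beta> by simp
    show "q ^ 3 * (\<alpha> / q) = \<alpha> * q ^ 2"
      using q by (simp add: eval_nat_numeral)
  qed
  have jprods: "theta_prod p (q ^ s) = H s * H (5 - s)" if "s \<le> 5" for s
    using quot(3)[OF that] by (simp add: theta_prod_def H_def)
  \<comment> \<open>Splitting off the factor 1 + \<beta> leaves arguments -\<alpha> p and -\<beta>
    p. Together with p these are p times the three cube roots of unity, so the product collapses to
    base p^3.\<close>
  have "theta_prod p (- \<beta>) = qpoch (- \<beta>) p * qpoch (- \<alpha> * p) p"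
    using quot(2)[of 0] by (simp add: theta_prod_def p_def)
  also have "qpoch (- \<beta>) p = (1 + \<beta>) * qpoch (- \<beta> * p) p"
    using qpoch_rec[OF p(1), of "- \<beta>"] by simp
  also have "qpoch (- \<alpha> * p) p * qpoch (- \<beta> * p) p * qpoch p p = qpoch (p ^ 3) (p ^ 3)"
    using qpoch_mult_sixth_roots[OF p(1) \<alpha>\<beta>(1,2), of "- p"] by simp
  hence "(1 + \<beta>) * qpoch (- \<beta> * p) p * qpoch (- \<alpha> * p) p =
      (1 + \<beta>) * (euler_E (q ^ 15) / euler_E (q ^ 5))"
    using euler_E_nz[of 5] by (simp add: euler_E_eq_qpoch p_def field_simps flip: power_mult)
  finally have j\<beta>: "theta_prod p (- \<beta>) = (1 + \<beta>) * (euler_E (q ^ 15) / euler_E (q ^ 5))" .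
  have six: "qpoch (\<alpha> * q ^ s) p * qpoch (\<beta> * q ^ s) p = G3 s / G s" if "s > 0" for s
    using qpoch_mult_sixth_roots[OF p(1) \<alpha>\<beta>(1,2), of "q ^ s"] GH[OF that]
    by (simp add: G_def G3_def field_simps flip: power_mult)
  have jsix: "theta_prod p (\<alpha> * q ^ s) * theta_prod p (\<beta> * q ^ s) =
      (G3 s / G s) * (G3 (5 - s) / G (5 - s))" if "0 < s" "s < 5" for s
    unfolding six[OF that(1), symmetric] six[OF zero_less_diff[THEN iffD2, OF that(2)], symmetric]
      theta_prod_def
    using quot[of s] that by (simp add: mult_ac)
  have E1: "euler_E q = H 1 * H 2 * H 3 * H 4 * H 5"
    using qpoch_split_power[of 1 5 1]
    by (simp add: euler_E_eq_qpoch H_def p_def prod_lessThan_numeral numeral_2_eq_2[symmetric] del: power_Suc)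
  have H5: "H 5 = euler_E (q ^ 5)"
    by (simp add: H_def p_def euler_E_eq_qpoch)
  have G1: "G 1 * G 2 * G 3 * G 4 * G 5 = euler_E (q ^ 2) / euler_E q"
    using qpoch_split_power[of 1 5 "- 1"] qpoch_uminus_self[of q] q
    by (simp add: G_def p_def prod_lessThan_numeral numeral_2_eq_2[symmetric] del: power_Suc)
  have G5: "G 5 = euler_E (q ^ 10) / euler_E (q ^ 5)"
    using qpoch_uminus_self[of "q ^ 5"] norm_power_less_1[of 5]
    by (simp add: G_def p_def flip: power_mult)
  have G31: "G3 1 * G3 2 * G3 3 * G3 4 * G3 5 = euler_E (q ^ 6) / euler_E (q ^ 3)"
    using qpoch_split_power[of 3 5 "- 1"] qpoch_uminus_self[of "q ^ 3"] norm_power_less_1[of 3]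
    by (simp add: G3_def p_def prod_lessThan_numeral flip: power_mult)
  have G35: "G3 5 = euler_E (q ^ 30) / euler_E (q ^ 15)"
    using qpoch_uminus_self[of "q ^ 15"] norm_power_less_1[of 15]
    by (simp add: G3_def p_def flip: power_mult)
  have "(\<alpha> - \<beta>) * suminf f = theta_zeta p (\<alpha> * q) + theta_zeta p (\<beta> * q ^ 2) + theta_zeta p (\<alpha> / q)
          - theta_zeta p (\<alpha> * q ^ 2) + 1"
    unfolding sum using zeta(1)[of 1] zeta(2)[of 2] zeta' zeta(1)[of 2] by simp
  also have "\<dots> = (qpoch p p)\<^sup>2 * theta_prod p (q ^ 3) * theta_prod p (- \<beta>) * theta_prod p q /
      (theta_prod p (\<alpha> * q) * theta_prod p (\<beta> * q ^ 2) * theta_prod p (\<alpha> / q) *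
       theta_prod p (\<alpha> * q ^ 2))"
    using theta_zeta_addition[OF p, of "\<alpha> * q" "\<beta> * q ^ 2" "\<alpha> / q"] nz[of 1 \<alpha>] nz[of 2 \<beta>] nz[of 2 \<alpha>]
      nz[of 1 \<beta>] nz[of 1 1] prod' norm\<alpha>\<beta> q \<alpha>\<beta>0 unfolding pw by simp
  also have "\<dots> = - \<beta> * q * ((qpoch p p)\<^sup>2 * theta_prod p (q ^ 3) * theta_prod p (- \<beta>) * theta_prod p q) /
      ((theta_prod p (\<alpha> * q) * theta_prod p (\<beta> * q)) *
       (theta_prod p (\<alpha> * q ^ 2) * theta_prod p (\<beta> * q ^ 2)))"
    unfolding prod' by (simp add: mult_ac)
  also have "\<dots> = - \<beta> * (1 + \<beta>) * (q * ((H 5)\<^sup>2 * (H 3 * H 2) * (euler_E (q ^ 15) / euler_E (q ^ 5)) * (H 1 * H 4)) /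
      ((G3 1 / G 1) * (G3 4 / G 4) * ((G3 2 / G 2) * (G3 3 / G 3))))"
    using jsix[of 1] jsix[of 2] jprods[of 3] jprods[of 1] j\<beta>
    by (simp add: mult_ac H_def p_def)
  \<comment> \<open>The constants left over from inverting \<beta> q and from j(-\<beta>) combine to
    the factor \<alpha> - \<beta> of the partial fractions.\<close>
  also have "- \<beta> * (1 + \<beta>) = \<alpha> - \<beta>"
  proof -
    have \<alpha>: "\<alpha> = 1 - \<beta>" using \<alpha>\<beta>(1) by (simp add: eq_diff_eq)
    have "\<beta> * \<beta> = \<beta> - 1" using \<alpha>\<beta>(2) unfolding \<alpha> by (simp add: algebra_simps)
    thus ?thesis unfolding \<alpha> by (simp add: algebra_simps)
  qed
  also have "(H 5)\<^sup>2 * (H 3 * H 2) * (euler_E (q ^ 15) / euler_E (q ^ 5)) * (H 1 * H 4) =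
      euler_E q * euler_E (q ^ 15)"
    unfolding E1 H5[symmetric] using GH by (simp add: power2_eq_square)
  also have "(G3 1 / G 1) * (G3 4 / G 4) * ((G3 2 / G 2) * (G3 3 / G 3)) =
      (euler_E (q ^ 6) / euler_E (q ^ 3)) / (euler_E (q ^ 30) / euler_E (q ^ 15)) /
      ((euler_E (q ^ 2) / euler_E q) / (euler_E (q ^ 10) / euler_E (q ^ 5)))"
    unfolding G1[symmetric] G5[symmetric] G31[symmetric] G35[symmetric] using GH
    by (simp add: field_simps)
  finally have "suminf f = q * (euler_E q * euler_E (q ^ 15)) /
      ((euler_E (q ^ 6) / euler_E (q ^ 3)) / (euler_E (q ^ 30) / euler_E (q ^ 15)) /
      ((euler_E (q ^ 2) / euler_E q) / (euler_E (q ^ 10) / euler_E (q ^ 5))))"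
    using \<alpha>\<beta>(3) by simp
  hence "Q_quotient q = suminf f"
    using euler_E_nz euler_E_nz[of 1] by (simp add: Q_quotient_def field_simps)
  thus ?thesis
    by (simp only: f_def)
qed

end

section \<open>The Jacobi triple product\<close>

text \<open>Dominated convergence for sums over the integers: Tannery's theorem for sequences,
  transported along the bijection \<open>int_decode\<close>.\<close>

lemma tendsto_infsum_int:
  fixes f :: "nat \<Rightarrow> int \<Rightarrow> complex"
  assumes lim: "\<And>k. (\<lambda>n. f n k) \<longlonglongrightarrow> g k"
    and bound: "\<And>n k. norm (f n k) \<le> M k" and M: "M summable_on UNIV"
  shows "(\<lambda>n. \<Sum>\<^sub>\<infinity>k. f n k) \<longlonglongrightarrow> (\<Sum>\<^sub>\<infinity>k. g k)"
proof -
  have sM: "summable (\<lambda>i. M (int_decode i))"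
    using summable_on_reindex_bij_betw[OF bij_int_decode, of M] M
    by (simp add: summable_on_imp_summable)
  have eq: "(\<Sum>\<^sub>\<infinity>k. h k) = (\<Sum>i. h (int_decode i))"
    if "\<And>k. norm (h k) \<le> M k" for h :: "int \<Rightarrow> complex"
  proof -
    have *: "summable (\<lambda>i. norm (h (int_decode i)))"
      by (rule summable_comparison_test'[OF sM]) (use that in auto)
    have "((\<lambda>i. h (int_decode i)) has_sum (\<Sum>i. h (int_decode i))) UNIV"
      by (rule norm_summable_imp_has_sum[OF * summable_sums[OF summable_norm_cancel[OF *]]])
    hence "(h has_sum (\<Sum>i. h (int_decode i))) UNIV"
      using has_sum_reindex_bij_betw[OF bij_int_decode, of h] by blast
    thus ?thesis
      by (rule infsumI)
  qed
  have g: "norm (g k) \<le> M k" for k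
    by (rule LIMSEQ_le_const2[OF tendsto_norm[OF lim]]) (use bound in blast)
  have "(\<forall>\<^sub>F n in sequentially. summable (\<lambda>i. norm (f n (int_decode i)))) \<and>
      summable (\<lambda>i. norm (g (int_decode i))) \<and>
      (\<lambda>n. \<Sum>i. f n (int_decode i)) \<longlonglongrightarrow> (\<Sum>i. g (int_decode i))"
    by (rule tannerys_theorem[where M = "\<lambda>i. M (int_decode i)"])
       (use lim sM bound in \<open>auto intro!: always_eventually\<close>)
  thus ?thesis
    by (simp add: eq bound g)
qed

definition qfac :: "complex \<Rightarrow> nat \<Rightarrow> complex" where
  "qfac p n = (\<Prod>k<n. 1 - p ^ Suc k)"

text \<open>The Gaussian binomial coefficient of 2n over n + k in base \<open>p\<close>. The zero
  value outside the range lets every sum run over all integers.\<close>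

definition central_qbinomial :: "complex \<Rightarrow> nat \<Rightarrow> int \<Rightarrow> complex" where
  "central_qbinomial p n k = (if \<bar>k\<bar> \<le> int n
     then qfac p (2 * n) / (qfac p (nat (int n - k)) * qfac p (nat (int n + k))) else 0)"

definition jacobi_term :: "complex \<Rightarrow> complex \<Rightarrow> int \<Rightarrow> complex" where
  "jacobi_term p z k = (- z) powi k * p powi (k * (k - 1) div 2)"

lemma sum_shift_int:
  fixes h :: "int \<Rightarrow> 'a::comm_monoid_add"
  assumes "\<And>k. \<bar>k\<bar> > int n \<Longrightarrow> h k = 0" "\<bar>c\<bar> \<le> 1"
  shows "(\<Sum>k\<in>{- int (Suc n)..int (Suc n)}. h (k - c)) = (\<Sum>k\<in>{- int n..int n}. h k)"
proof -
  have "(\<Sum>k\<in>{- int (Suc n)..int (Suc n)}. h (k - c)) = (\<Sum>k\<in>{- int n + c..int n + c}. h (k - c))"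
    by (rule sum.mono_neutral_right) (use assms in auto)
  also have "\<dots> = (\<Sum>k\<in>{- int n..int n}. h k)"
    by (rule sum.reindex_bij_witness[of _ "\<lambda>k. k + c" "\<lambda>k. k - c"]) auto
  finally show ?thesis .
qed

context
  fixes p :: complex
  assumes p: "norm p < 1" "p \<noteq> 0"
begin

lemma one_minus_power_nonzero: "1 - p ^ Suc k \<noteq> 0"
proof
  assume "1 - p ^ Suc k = 0"
  hence "norm (p ^ Suc k) = 1" by simp
  moreover have "norm (p ^ Suc k) < 1"
    unfolding norm_power using p by (intro power_Suc_less_one) auto
  ultimately show False by simp
qed

lemma qfac_nonzero: "qfac p n \<noteq> 0"
  using one_minus_power_nonzero by (simp add: qfac_def)

lemma qfac_Suc: "qfac p (Suc n) = qfac p n * (1 - p ^ Suc n)"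
  by (simp add: qfac_def)

lemma qfac_LIMSEQ: "qfac p \<longlonglongrightarrow> euler_E p"
  using qpoch_LIMSEQ[OF p(1), of p] by (simp add: qfac_def[abs_def] euler_E_eq_qpoch)

text \<open>Since \<open>qfac p\<close> converges to a nonzero limit, it and its reciprocal are
  bounded. The resulting bound, uniform in n and k, provides the domination for the limit in the
  triple product.\<close>

lemma central_qbinomial_bounded: "\<exists>C. \<forall>n k. norm (central_qbinomial p n k) \<le> C"
proof -
  obtain U where U: "\<And>n. norm (qfac p n) \<le> U"
    using convergent_imp_Bseq[OF convergentI[OF qfac_LIMSEQ]] by (auto simp: Bseq_def)
  have "(\<lambda>n. inverse (qfac p n)) \<longlonglongrightarrow> inverse (euler_E p)"
    by (intro tendsto_inverse qfac_LIMSEQ euler_E_nonzero p)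
  then obtain V where V: "\<And>n. norm (inverse (qfac p n)) \<le> V"
    using convergent_imp_Bseq[OF convergentI] by (meson Bseq_def)
  have UV: "U \<ge> 0" "V \<ge> 0"
    using norm_ge_zero U V order_trans by blast+
  have "norm (central_qbinomial p n k) \<le> U * (V * V)" for n k
  proof (cases "\<bar>k\<bar> \<le> int n")
    case True
    have "norm (central_qbinomial p n k) = norm (qfac p (2 * n)) *
        (norm (inverse (qfac p (nat (int n - k)))) * norm (inverse (qfac p (nat (int n + k)))))"
      using True by (simp add: central_qbinomial_def norm_divide norm_mult divide_inverse norm_inverse)
    also have "\<dots> \<le> U * (V * V)"
      by (intro mult_mono U V UV mult_nonneg_nonneg norm_ge_zero)
    finally show ?thesis .
  qed (use UV in \<open>simp add: central_qbinomial_def\<close>)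
  thus ?thesis by blast
qed

lemma central_qbinomial_LIMSEQ: "(\<lambda>n. central_qbinomial p n k) \<longlonglongrightarrow> inverse (euler_E p)"
proof -
  have "filterlim (\<lambda>n. nat (int n - k)) at_top sequentially"
    "filterlim (\<lambda>n. nat (int n + k)) at_top sequentially"
    "filterlim (\<lambda>n::nat. 2 * n) at_top sequentially"
    unfolding filterlim_at_top eventually_sequentially
    by (intro allI, rule_tac x = "nat (int Z + \<bar>k\<bar>)" in exI, force)+
  note * = this[THEN filterlim_compose[OF qfac_LIMSEQ]]
  have "(\<lambda>n. qfac p (2 * n) / (qfac p (nat (int n - k)) * qfac p (nat (int n + k))))
      \<longlonglongrightarrow> euler_E p / (euler_E p * euler_E p)"
    using euler_E_nonzero[OF p(1)] by (intro tendsto_intros *) auto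
  also have "euler_E p / (euler_E p * euler_E p) = inverse (euler_E p)"
    using euler_E_nonzero[OF p(1)] by (simp add: field_simps)
  finally show ?thesis
  proof (rule Lim_transform_eventually)
    show "\<forall>\<^sub>F n in sequentially. qfac p (2 * n) / (qfac p (nat (int n - k)) * qfac p (nat (int n + k)))
        = central_qbinomial p n k"
      using eventually_ge_at_top[of "nat \<bar>k\<bar>"]
      by eventually_elim (auto simp: central_qbinomial_def)
  qed
qed

text \<open>Two Pascal steps at once. The coefficients are those that arise from multiplying by (1 -
  z p^n)(1 - p^(n+1)/z).\<close>

lemma central_qbinomial_rec:
  assumes "\<bar>k\<bar> \<le> int (Suc n)"
  shows "central_qbinomial p (Suc n) k = (1 + p ^ (2 * n + 1)) * central_qbinomial p n k
    + p powi (int n + 1 - k) * central_qbinomial p n (k - 1)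
    + p powi (int n + 1 + k) * central_qbinomial p n (k + 1)"
proof -
  have qfac0: "qfac p 0 = 1" by (simp add: qfac_def)
  consider "k = int (Suc n)" | "k = - int (Suc n)" | "\<bar>k\<bar> \<le> int n"
    using assms by linarith
  thus ?thesis
  proof cases
    case 1
    have "nat (int (Suc n) + int (Suc n)) = 2 * Suc n" "nat (int n + int n) = 2 * n" by auto
    thus ?thesis
      using qfac_nonzero 1 by (simp add: central_qbinomial_def qfac0)
  next
    case 2
    have "nat (int (Suc n) + int (Suc n)) = 2 * Suc n" "nat (int n + int n) = 2 * n" by auto
    thus ?thesis
      using qfac_nonzero 2 by (simp add: central_qbinomial_def qfac0)
  next
    case 3
    define L M where "L = nat (int n + k)" and "M = nat (int n - k)"
    have LM: "int L = int n + k" "int M = int n - k" "L + M = 2 * n"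
      using 3 by (auto simp: L_def M_def)
    \<comment> \<open>All coefficients involved are multiples of \<open>D\<close>. If a neighbour of
      \<open>k\<close> leaves the range, a factor 1 - p^0 vanishes, so the same formulas remain
      valid.\<close>
    define D where "D = qfac p (2 * n) / (qfac p (Suc M) * qfac p (Suc L))"
    have b0: "central_qbinomial p n k = D * ((1 - p ^ Suc M) * (1 - p ^ Suc L))"
      using 3 one_minus_power_nonzero qfac_nonzero
      by (simp add: central_qbinomial_def D_def L_def[symmetric] M_def[symmetric] qfac_Suc
          del: power_Suc)
    have b1: "central_qbinomial p n (k - 1) = D * ((1 - p ^ L) * (1 - p ^ Suc L))"
    proof (cases L)
      case 0
      have "\<not> \<bar>k - 1\<bar> \<le> int n" using LM 0 by linarith
      thus ?thesis using 0 by (simp only: central_qbinomial_def if_False) simp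
    next
      case (Suc l)
      have "int n - (k - 1) = int (Suc M)" "int n + (k - 1) = int l" "\<bar>k - 1\<bar> \<le> int n"
        using LM Suc 3 by linarith+
      hence "nat (int n - (k - 1)) = Suc M" "nat (int n + (k - 1)) = l" "\<bar>k - 1\<bar> \<le> int n"
        by (simp_all only: nat_int)
      thus ?thesis
        using Suc one_minus_power_nonzero qfac_nonzero
        by (simp add: central_qbinomial_def D_def qfac_Suc del: power_Suc)
    qed
    have b2: "central_qbinomial p n (k + 1) = D * ((1 - p ^ M) * (1 - p ^ Suc M))"
    proof (cases M)
      case 0
      have "\<not> \<bar>k + 1\<bar> \<le> int n" using LM 0 by linarith
      thus ?thesis using 0 by (simp only: central_qbinomial_def if_False) simp
    next
      case (Suc m)
      have "int n - (k + 1) = int m" "int n + (k + 1) = int (Suc L)" "\<bar>k + 1\<bar> \<le> int n"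
        using LM Suc 3 by linarith+
      hence "nat (int n - (k + 1)) = m" "nat (int n + (k + 1)) = Suc L" "\<bar>k + 1\<bar> \<le> int n"
        by (simp_all only: nat_int)
      thus ?thesis
        using Suc one_minus_power_nonzero qfac_nonzero
        by (simp add: central_qbinomial_def D_def qfac_Suc del: power_Suc)
    qed
    have "int (Suc n) - k = int (Suc M)" "int (Suc n) + k = int (Suc L)" "\<bar>k\<bar> \<le> int (Suc n)"
      using LM 3 by linarith+
    moreover have "qfac p (2 * Suc n) = qfac p (2 * n) * (1 - p ^ (2 * n + 1)) * (1 - p ^ (2 * n + 2))"
      by (simp add: qfac_Suc)
    ultimately have b: "central_qbinomial p (Suc n) k =
        D * ((1 - p ^ (2 * n + 1)) * (1 - p ^ (2 * n + 2)))"
      by (simp only: central_qbinomial_def D_def if_True nat_int) simp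
    have e: "p powi (int n + 1 - k) = p * p ^ M" "p powi (int n + 1 + k) = p * p ^ L"
    proof -
      have "int n + 1 - k = int (Suc M)" "int n + 1 + k = int (Suc L)"
        using LM by auto
      thus "p powi (int n + 1 - k) = p * p ^ M" "p powi (int n + 1 + k) = p * p ^ L"
        by (simp_all only: power_int_of_nat power_Suc)
    qed
    have e2: "p ^ (2 * n + 1) = p * p ^ L * p ^ M" "p ^ (2 * n + 2) = p * p * p ^ L * p ^ M"
      unfolding LM(3)[symmetric] by (simp_all add: power_add)
    show ?thesis
      unfolding b b0 b1 b2 e e2 by (simp add: algebra_simps)
  qed
qed

lemma jacobi_term_shift:
  assumes "z \<noteq> 0"
  shows "jacobi_term p z (k + 1) = - z * p powi k * jacobi_term p z k"
proof -
  have "(k + 1) * (k + 1 - 1) div 2 = k + k * (k - 1) div 2"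
  proof -
    have "(k + 1) * (k + 1 - 1) = k * 2 + k * (k - 1)" by (simp add: algebra_simps)
    thus ?thesis by simp
  qed
  thus ?thesis
    using assms p by (simp add: jacobi_term_def power_int_add)
qed

text \<open>The new factor consists of a constant, a multiple of z and a multiple of 1/z. The last
  two shift the summation index by one, and \<open>jacobi_term_shift\<close> matches them with the
  neighbours in \<open>central_qbinomial_rec\<close>.\<close>

lemma finite_jacobi_triple_product:
  assumes z: "z \<noteq> 0"
  shows "(\<Prod>k<n. (1 - z * p ^ k) * (1 - p ^ Suc k / z)) =
    (\<Sum>k\<in>{- int n..int n}. jacobi_term p z k * central_qbinomial p n k)"
proof (induction n)
  case 0
  show ?case by (simp add: jacobi_term_def central_qbinomial_def qfac_def)
next
  case (Suc n)
  let ?t = "jacobi_term p z" and ?b = "central_qbinomial p n"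
  let ?S = "\<Sum>k\<in>{- int n..int n}. ?t k * ?b k"
  have out: "?b k = 0" if "\<bar>k\<bar> > int n" for k
    using that by (simp add: central_qbinomial_def)
  have "(\<Sum>k\<in>{- int (Suc n)..int (Suc n)}. ?t k * central_qbinomial p (Suc n) k) =
      (\<Sum>k\<in>{- int (Suc n)..int (Suc n)}. (1 + p ^ (2 * n + 1)) * (?t (k - 0) * ?b (k - 0))
        + ?t k * p powi (int n + 1 - k) * ?b (k - 1)
        + ?t k * p powi (int n + 1 + k) * ?b (k - (- 1)))"
  proof (rule sum.cong)
    fix k assume "k \<in> {- int (Suc n)..int (Suc n)}"
    hence rec: "central_qbinomial p (Suc n) k = (1 + p ^ (2 * n + 1)) * ?b k
      + p powi (int n + 1 - k) * ?b (k - 1) + p powi (int n + 1 + k) * ?b (k + 1)"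
      by (intro central_qbinomial_rec) auto
    show "?t k * central_qbinomial p (Suc n) k = (1 + p ^ (2 * n + 1)) * (?t (k - 0) * ?b (k - 0))
        + ?t k * p powi (int n + 1 - k) * ?b (k - 1)
        + ?t k * p powi (int n + 1 + k) * ?b (k - (- 1))"
      unfolding rec by (simp add: distrib_left mult.assoc mult.left_commute)
  qed auto
  also have "\<dots> = (1 + p ^ (2 * n + 1)) * ?S
      + (\<Sum>k\<in>{- int (Suc n)..int (Suc n)}. ?t k * p powi (int n + 1 - k) * ?b (k - 1))
      + (\<Sum>k\<in>{- int (Suc n)..int (Suc n)}. ?t k * p powi (int n + 1 + k) * ?b (k - (- 1)))"
    unfolding sum.distrib sum_distrib_left[symmetric]
    by (subst sum_shift_int[of n "\<lambda>k. ?t k * ?b k" 0]) (auto simp: out)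
  also have "(\<Sum>k\<in>{- int (Suc n)..int (Suc n)}. ?t k * p powi (int n + 1 - k) * ?b (k - 1)) =
      (\<Sum>k\<in>{- int (Suc n)..int (Suc n)}. - z * p ^ n * (?t (k - 1) * ?b (k - 1)))"
  proof (rule sum.cong)
    fix k
    have "?t k * p powi (int n + 1 - k) = - z * ?t (k - 1) * (p powi (k - 1) * p powi (int n + 1 - k))"
      using jacobi_term_shift[OF z, of "k - 1"] by simp
    also have "p powi (k - 1) * p powi (int n + 1 - k) = p ^ n"
      using p by (simp flip: power_int_add)
    finally show "?t k * p powi (int n + 1 - k) * ?b (k - 1) = - z * p ^ n * (?t (k - 1) * ?b (k - 1))"
      by simp
  qed auto
  also have "\<dots> = - z * p ^ n * ?S"
    unfolding sum_distrib_left[symmetric]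
    by (subst sum_shift_int[of n "\<lambda>k. ?t k * ?b k" 1]) (auto simp: out)
  also have "(\<Sum>k\<in>{- int (Suc n)..int (Suc n)}. ?t k * p powi (int n + 1 + k) * ?b (k - (- 1))) =
      (\<Sum>k\<in>{- int (Suc n)..int (Suc n)}. - (p ^ Suc n / z) * (?t (k - (- 1)) * ?b (k - (- 1))))"
  proof (rule sum.cong)
    fix k
    have "p powi (int n + 1 + k) = p ^ Suc n * p powi k"
      using p by (simp add: power_int_add)
    thus "?t k * p powi (int n + 1 + k) * ?b (k - (- 1)) =
        - (p ^ Suc n / z) * (?t (k - (- 1)) * ?b (k - (- 1)))"
      using jacobi_term_shift[OF z, of k] z by simp
  qed auto
  also have "\<dots> = - (p ^ Suc n / z) * ?S"
    unfolding sum_distrib_left[symmetric]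
    by (subst sum_shift_int[of n "\<lambda>k. ?t k * ?b k" "- 1"]) (auto simp: out)
  also have "(1 + p ^ (2 * n + 1)) * ?S + - z * p ^ n * ?S + - (p ^ Suc n / z) * ?S =
      ?S * ((1 - z * p ^ n) * (1 - p ^ Suc n / z))"
  proof -
    have "p ^ (2 * n + 1) = p ^ n * p ^ Suc n"
      by (simp flip: power_add add: mult_2)
    thus ?thesis
      using z by (simp only:) (simp add: field_simps)
  qed
  finally show ?case
    using Suc by simp
qed

text \<open>The limit of the finite version under domination: every binomial coefficient tends to
  1/E(p).\<close>

theorem jacobi_triple_product:
  assumes z: "z \<noteq> 0" and summ: "jacobi_term p z summable_on UNIV"
  shows "(\<Sum>\<^sub>\<infinity>k. jacobi_term p z k) = euler_E p * theta_prod p z"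
proof -
  obtain C where C: "\<And>n k. norm (central_qbinomial p n k) \<le> C"
    using central_qbinomial_bounded by blast
  have "(\<lambda>n. \<Sum>\<^sub>\<infinity>k. jacobi_term p z k * central_qbinomial p n k)
      \<longlonglongrightarrow> (\<Sum>\<^sub>\<infinity>k. jacobi_term p z k * inverse (euler_E p))"
  proof (rule tendsto_infsum_int)
    show "(\<lambda>k. norm (jacobi_term p z k) * C) summable_on UNIV"
      using summ by (intro summable_on_cmult_left) (simp add: summable_on_iff_abs_summable_on_complex)
  qed (auto intro!: tendsto_intros central_qbinomial_LIMSEQ mult_left_mono C simp: norm_mult)
  moreover have "(\<Sum>\<^sub>\<infinity>k. jacobi_term p z k * central_qbinomial p n k) =
      (\<Prod>k<n. 1 - z * p ^ k) * (\<Prod>k<n. 1 - p / z * p ^ k)" for n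
  proof -
    have "(\<Sum>\<^sub>\<infinity>k. jacobi_term p z k * central_qbinomial p n k) =
        (\<Sum>\<^sub>\<infinity>k\<in>{- int n..int n}. jacobi_term p z k * central_qbinomial p n k)"
      by (rule infsum_cong_neutral) (auto simp: central_qbinomial_def)
    thus ?thesis
      using finite_jacobi_triple_product[OF z, of n] by (simp add: prod.distrib)
  qed
  moreover have "(\<lambda>n. (\<Prod>k<n. 1 - z * p ^ k) * (\<Prod>k<n. 1 - p / z * p ^ k)) \<longlonglongrightarrow> theta_prod p z"
    unfolding theta_prod_def by (intro tendsto_mult qpoch_LIMSEQ p)
  ultimately have "(\<Sum>\<^sub>\<infinity>k. jacobi_term p z k * inverse (euler_E p)) = theta_prod p z"
    by (simp add: LIMSEQ_unique)
  hence "(\<Sum>\<^sub>\<infinity>k. jacobi_term p z k) * inverse (euler_E p) = theta_prod p z"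
    by (simp add: infsum_cmult_left')
  thus ?thesis
    using euler_E_nonzero[OF p(1)] by (simp add: field_simps)
qed

end

section \<open>Product formulas for the theta series\<close>

lemma summable_on_quadratic_power:
  fixes q :: complex and e :: "int \<Rightarrow> nat"
  assumes "norm q < 1" "\<And>k. \<bar>k\<bar> \<le> int (e k) + 1"
  shows "(\<lambda>k. q ^ e k) summable_on UNIV"
proof (cases "q = 0")
  case True
  have "{k. e k = 0} \<subseteq> {-1..1}"
  proof
    fix k assume "k \<in> {k. e k = 0}"
    thus "k \<in> {-1..1}" using assms(2)[of k] by auto
  qed
  hence "finite {k. e k = 0}"
    using finite_subset by blast
  hence "(\<lambda>k. q ^ e k) summable_on {k. e k = 0}"
    by (rule summable_on_finite)
  thus ?thesis
    by (rule summable_on_cong_neutral[THEN iffD1, rotated -1]) (use True in auto)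
next
  case False
  \<comment> \<open>The division by |q| pays for the slack of 1 in the bound on |k|.\<close>
  have geo: "(\<lambda>n. norm q ^ n / norm q) summable_on UNIV"
    using assms by (intro summable_nonneg_imp_summable_on summable_divide) (auto simp: summable_geometric)
  have "(\<lambda>n. q ^ e (g n)) summable_on UNIV" if "\<And>n. \<bar>g n\<bar> = int n" for g :: "nat \<Rightarrow> int"
  proof (rule abs_summable_summable, rule summable_on_comparison_test[OF geo])
    fix n
    have "n \<le> Suc (e (g n))"
      using assms(2)[of "g n"] that[of n] by linarith
    hence "norm q ^ Suc (e (g n)) \<le> norm q ^ n"
      using assms by (intro power_decreasing) auto
    thus "norm (q ^ e (g n)) \<le> norm q ^ n / norm q"
      using False by (simp add: norm_power field_simps)
  qed auto
  note * = this[of int] this[of "\<lambda>n. - int n"]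
  have "(\<lambda>k. q ^ e k) summable_on range int"
    using * by (subst summable_on_reindex) (auto simp: o_def)
  moreover have "(\<lambda>k. q ^ e k) summable_on range (\<lambda>n. - int n)"
    using * by (subst summable_on_reindex) (auto simp: o_def inj_on_def)
  ultimately have "(\<lambda>k. q ^ e k) summable_on (range int \<union> range (\<lambda>n. - int n))"
    by (rule summable_on_union)
  moreover have "range int \<union> range (\<lambda>n. - int n) = UNIV"
    by (auto simp: image_iff) (metis int_cases2)
  ultimately show ?thesis by simp
qed

text \<open>Summing over all integers makes this twice Ramanujan's \<open>\<psi>\<close>.\<close>
definition theta_tri :: "complex \<Rightarrow> complex" where
  "theta_tri q = (\<Sum>\<^sub>\<infinity>k::int. q ^ nat (k * (k - 1) div 2))"

lemma triangular_bound: "\<bar>k\<bar> \<le> int (nat (k * (k - 1) div 2)) + 1" "k * (k - 1) div 2 \<ge> 0"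
proof -
  have *: "2 * \<bar>k\<bar> \<le> k * (k - 1) + 2"
  proof (cases "k \<ge> 2")
    case True
    hence "2 * (k - 1) \<le> k * (k - 1)" by (intro mult_right_mono) auto
    thus ?thesis using True by simp
  next
    case False
    show ?thesis
    proof (cases "k \<ge> 0")
      case True
      with False have "k = 0 \<or> k = 1" by auto
      thus ?thesis by auto
    next
      case neg: False
      have "- k * (1 - k) \<ge> - k * 2" if "k \<noteq> - 1"
        using neg that by (intro mult_left_mono) auto
      thus ?thesis using neg by (cases "k = - 1") (auto simp: algebra_simps)
    qed
  qed
  have "k * (k - 1) \<ge> 0"
    by (cases "k \<ge> 1") (auto intro: mult_nonneg_nonneg mult_nonpos_nonpos)
  thus **: "k * (k - 1) div 2 \<ge> 0" by simp
  have "2 * (k * (k - 1) div 2) = k * (k - 1)" by simp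
  with * ** show "\<bar>k\<bar> \<le> int (nat (k * (k - 1) div 2)) + 1" by linarith
qed

context punctured_disc
begin

text \<open>The triple product in base q^2 at z = q; both Pochhammer factors become (q;
  q^2).\<close>

lemma theta_phi_uminus: "theta_phi (- q) = (euler_E q)\<^sup>2 / euler_E (q\<^sup>2)"
proof -
  have q2: "norm (q\<^sup>2) < 1" "q\<^sup>2 \<noteq> 0"
    using q norm_power_less_1[of 2] by auto
  have trm: "jacobi_term (q\<^sup>2) q k = (- q) ^ nat (k\<^sup>2)" for k
  proof -
    have "k + 2 * (k * (k - 1) div 2) = k\<^sup>2"
      by (simp add: power2_eq_square algebra_simps)
    moreover have "(- q) powi (2 * m) = (q\<^sup>2) powi m" for m
      by (simp only: power_int_mult) simp
    hence "jacobi_term (q\<^sup>2) q k = (- q) powi (k + 2 * (k * (k - 1) div 2))"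
      using q by (subst power_int_add) (auto simp only: jacobi_term_def neg_equal_0_iff_equal)
    ultimately show ?thesis
      by (simp add: power_int_def)
  qed
  have "theta_phi (- q) = euler_E (q\<^sup>2) * theta_prod (q\<^sup>2) q"
    using jacobi_triple_product[OF q2 q(2)] theta_phi_summable[of "- q"] q
    by (simp add: theta_phi_def trm[abs_def])
  also have "theta_prod (q\<^sup>2) q = (qpoch q (q\<^sup>2))\<^sup>2"
    using q by (simp add: theta_prod_def power2_eq_square)
  also have "qpoch q (q\<^sup>2) = euler_E q / euler_E (q\<^sup>2)"
    using qpoch_split[OF q(1), of 2 q] euler_E_nz[of 2]
    by (simp add: euler_E_eq_qpoch lessThan_Suc numeral_2_eq_2 field_simps power2_eq_square)
  finally show ?thesis
    using euler_E_nz[of 2] by (simp add: power2_eq_square)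
qed

text \<open>The triple product in base q at z = -1. The factor 2 is the first factor of (-1; q),
  after which both halves agree.\<close>

lemma theta_tri_eq: "theta_tri q = 2 * (euler_E (q\<^sup>2))\<^sup>2 / euler_E q"
proof -
  have trm: "jacobi_term q (- 1) k = q ^ nat (k * (k - 1) div 2)" for k
    using triangular_bound(2)[of k] by (simp add: jacobi_term_def power_int_def)
  have "theta_tri q = euler_E q * theta_prod q (- 1)"
    using jacobi_triple_product[OF q, of "- 1"] summable_on_quadratic_power[OF q(1) triangular_bound(1)]
    by (simp add: theta_tri_def trm[abs_def])
  also have "theta_prod q (- 1) = 2 * (qpoch (- q) q)\<^sup>2"
    using qpoch_rec[OF q(1), of "- 1"] by (simp add: theta_prod_def power2_eq_square)
  finally show ?thesis
    using euler_E_nz[of 1] by (simp add: qpoch_uminus_self[OF q(1)] power2_eq_square)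
qed

end

section \<open>Two identities between products of theta series\<close>

lemma infsum_product_complex:
  fixes f :: "'a \<Rightarrow> complex" and g :: "'b \<Rightarrow> complex"
  assumes f: "f summable_on A" and g: "g summable_on B"
  shows "(\<lambda>(x, y). f x * g y) summable_on A \<times> B"
    and "infsum f A * infsum g B = (\<Sum>\<^sub>\<infinity>(x, y)\<in>A \<times> B. f x * g y)"
proof -
  have abs: "(\<lambda>x. norm (f x)) summable_on A" "(\<lambda>x. norm (g x)) summable_on B"
    using f g by (simp_all add: summable_on_iff_abs_summable_on_complex)
  have "(\<lambda>z. norm (case z of (x, y) \<Rightarrow> f x * g y)) summable_on A \<times> B"
    unfolding Infinite_Sum.abs_summable_on_Sigma_iff using abs
    by (simp add: norm_mult abs_mult infsum_nonneg infsum_cmult_right' summable_on_cmult_right summable_on_cmult_left)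
  thus *: "(\<lambda>(x, y). f x * g y) summable_on A \<times> B"
    by (simp add: summable_on_iff_abs_summable_on_complex)
  have "infsum f A * infsum g B = (\<Sum>\<^sub>\<infinity>x\<in>A. \<Sum>\<^sub>\<infinity>y\<in>B. f x * g y)"
    by (simp add: infsum_cmult_right' infsum_cmult_left')
  also have "\<dots> = (\<Sum>\<^sub>\<infinity>(x, y)\<in>A \<times> B. f x * g y)"
    by (rule infsum_Sigma'_banach[OF *])
  finally show "infsum f A * infsum g B = (\<Sum>\<^sub>\<infinity>(x, y)\<in>A \<times> B. f x * g y)" .
qed

text \<open>The divisor 8 comes from k(k-1)/2 = ((2k-1)^2 - 1)/8, which lets theta series and
  triangular series be sums of one function over different classes of pairs. On the classes that
  occur in the two identities the division is exact.\<close>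

definition qform :: "complex \<Rightarrow> nat \<Rightarrow> nat \<Rightarrow> int \<times> int \<Rightarrow> complex" where
  "qform q a b = (\<lambda>(x, y). q ^ nat ((int a * x\<^sup>2 + int b * y\<^sup>2) div 8))"

definition qsum :: "complex \<Rightarrow> nat \<Rightarrow> nat \<Rightarrow> (int \<Rightarrow> int \<Rightarrow> bool) \<Rightarrow> complex" where
  "qsum q a b P = infsum (qform q a b) {(x, y). P x y}"

lemma theta_phi_mult:
  assumes "norm q < 1" "a > 0" "b > 0"
  shows "theta_phi (q ^ a) * theta_phi (q ^ b) =
    (\<Sum>\<^sub>\<infinity>(m, n)\<in>UNIV. q ^ nat (int a * m\<^sup>2 + int b * n\<^sup>2))"
proof -
  have "norm (q ^ a) < 1" "norm (q ^ b) < 1"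
    using assms by (simp_all add: norm_power power_less_one_iff)
  hence "theta_phi (q ^ a) * theta_phi (q ^ b) =
    (\<Sum>\<^sub>\<infinity>(m, n)\<in>UNIV \<times> UNIV. (q ^ a) ^ nat (m\<^sup>2) * (q ^ b) ^ nat (n\<^sup>2))"
    unfolding theta_phi_def by (intro infsum_product_complex theta_phi_summable)
  also have "\<dots> = (\<Sum>\<^sub>\<infinity>(m, n)\<in>UNIV \<times> UNIV. q ^ nat (int a * m\<^sup>2 + int b * n\<^sup>2))"
    by (intro infsum_cong)
       (auto simp: nat_add_distrib nat_mult_distrib power_add power_mult)
  finally show ?thesis by simp
qed

context punctured_disc
begin

lemma qform_summable:
  assumes "a > 0" "b > 0"
  shows "qform q a b summable_on T"
proof -
  \<comment> \<open>An eighth root of |q| absorbs the division by 8; rounding down loses at most 7,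
    hence the factor 1/s^7 below.\<close>
  define s where "s = norm q powr (1 / 8)"
  have s: "s > 0" "s < 1" "s ^ 8 = norm q"
    using q powr_less_mono2[of "1 / 8" "norm q" 1] by (simp_all add: s_def powr_power)
  have "(\<lambda>(x, y). complex_of_real s ^ nat (x\<^sup>2) * complex_of_real s ^ nat (y\<^sup>2))
      summable_on (UNIV \<times> UNIV)"
    using s by (intro infsum_product_complex theta_phi_summable) auto
  hence "(\<lambda>z. norm (case z of (x, y) \<Rightarrow> complex_of_real s ^ nat (x\<^sup>2) * complex_of_real s ^ nat (y\<^sup>2)))
      summable_on UNIV"
    by (simp add: summable_on_iff_abs_summable_on_complex)
  hence "(\<lambda>z. norm (case z of (x, y) \<Rightarrow> complex_of_real s ^ nat (x\<^sup>2) * complex_of_real s ^ nat (y\<^sup>2))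
      * (1 / s ^ 7)) summable_on UNIV"
    by (rule summable_on_cmult_left)
  hence "(\<lambda>z. norm (qform q a b z)) summable_on UNIV"
  proof (rule summable_on_comparison_test)
    fix z :: "int \<times> int"
    obtain x y where z: "z = (x, y)" by (cases z)
    define t where "t = int a * x\<^sup>2 + int b * y\<^sup>2"
    have "x\<^sup>2 \<le> int a * x\<^sup>2" "y\<^sup>2 \<le> int b * y\<^sup>2"
      using assms by (simp_all add: mult_le_cancel_right1)
    hence t: "x\<^sup>2 + y\<^sup>2 \<le> t" "t \<ge> 0"
      by (simp_all add: t_def)
    have "t \<le> 8 * (t div 8) + 7" by simp
    with t have "nat (x\<^sup>2) + nat (y\<^sup>2) \<le> 8 * nat (t div 8) + 7"
      by (simp add: nat_le_iff flip: nat_add_distrib)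
    hence "s ^ (8 * nat (t div 8) + 7) \<le> s ^ (nat (x\<^sup>2) + nat (y\<^sup>2))"
      using s by (intro power_decreasing) auto
    hence "norm q ^ nat (t div 8) * s ^ 7 \<le> s ^ nat (x\<^sup>2) * s ^ nat (y\<^sup>2)"
      by (simp only: power_add power_mult s(3))
    hence "norm q ^ nat (t div 8) \<le> s ^ nat (x\<^sup>2) * s ^ nat (y\<^sup>2) * (1 / s ^ 7)"
      using s by (simp add: field_simps)
    thus "norm (qform q a b z) \<le> norm (case z of (x, y) \<Rightarrow> complex_of_real s ^ nat (x\<^sup>2) *
        complex_of_real s ^ nat (y\<^sup>2)) * (1 / s ^ 7)"
      using s by (simp add: z qform_def t_def norm_power norm_mult)
  qed auto
  hence "qform q a b summable_on UNIV"
    by (rule abs_summable_summable)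
  thus ?thesis
    by (rule summable_on_subset_banach) auto
qed

context
  fixes a b :: nat
  assumes ab: "a > 0" "b > 0"
begin

lemma qsum_split:
  assumes "\<And>x y. R x y \<longleftrightarrow> P x y \<or> Q x y" "\<And>x y. \<not> (P x y \<and> Q x y)"
  shows "qsum q a b R = qsum q a b P + qsum q a b Q"
proof -
  have "{(x, y). R x y} = {(x, y). P x y} \<union> {(x, y). Q x y}" "{(x, y). P x y} \<inter> {(x, y). Q x y} = {}"
    using assms by auto
  thus ?thesis
    unfolding qsum_def using qform_summable[OF ab] by (simp add: infsum_Un_disjoint)
qed

lemma qsum_reflect:
  assumes "\<And>x y. Q x y \<longleftrightarrow> P x (- y)"
  shows "qsum q a b P = qsum q a b Q"
  unfolding qsum_def
  by (rule infsum_reindex_bij_witness[of _ "\<lambda>(x, y). (x, - y)" "\<lambda>(x, y). (x, - y)"])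
     (use assms in \<open>auto simp: qform_def\<close>)

text \<open>Odd numbers satisfy x = y, -y, 3y or -3y modulo 8 in exactly one way, and y -> -y
  exchanges the signs.\<close>

lemma qsum_odd_split:
  "qsum q a b (\<lambda>x y. odd x \<and> odd y) =
     2 * qsum q a b (\<lambda>x y. odd y \<and> 8 dvd x - y) + 2 * qsum q a b (\<lambda>x y. odd y \<and> 8 dvd x - 3 * y)"
proof -
  have "qsum q a b (\<lambda>x y. odd x \<and> odd y) =
      qsum q a b (\<lambda>x y. odd y \<and> (8 dvd x - y \<or> 8 dvd x + y)) +
      qsum q a b (\<lambda>x y. odd y \<and> (8 dvd x - 3 * y \<or> 8 dvd x + 3 * y))"
    by (rule qsum_split) presburger+
  also have "qsum q a b (\<lambda>x y. odd y \<and> (8 dvd x - y \<or> 8 dvd x + y)) =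
      qsum q a b (\<lambda>x y. odd y \<and> 8 dvd x - y) + qsum q a b (\<lambda>x y. odd y \<and> 8 dvd x + y)"
    by (rule qsum_split) presburger+
  also have "qsum q a b (\<lambda>x y. odd y \<and> (8 dvd x - 3 * y \<or> 8 dvd x + 3 * y)) =
      qsum q a b (\<lambda>x y. odd y \<and> 8 dvd x - 3 * y) + qsum q a b (\<lambda>x y. odd y \<and> 8 dvd x + 3 * y)"
    by (rule qsum_split) presburger+
  also have "qsum q a b (\<lambda>x y. odd y \<and> 8 dvd x + y) = qsum q a b (\<lambda>x y. odd y \<and> 8 dvd x - y)"
    by (rule qsum_reflect) simp
  also have "qsum q a b (\<lambda>x y. odd y \<and> 8 dvd x + 3 * y) = qsum q a b (\<lambda>x y. odd y \<and> 8 dvd x - 3 * y)"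
    by (rule qsum_reflect) simp
  finally show ?thesis by simp
qed

text \<open>If y is 2 modulo 4, then y -> -y changes x - y by 4 modulo 8. So these y contribute
  equally to both classes and cancel from the difference, leaving the multiples of 4.\<close>

lemma qsum_even_split:
  "qsum q a b (\<lambda>x y. even y \<and> 8 dvd x - y) =
     qsum q a b (\<lambda>x y. 4 dvd y \<and> 8 dvd x - y) - qsum q a b (\<lambda>x y. 4 dvd y \<and> 8 dvd x - y - 4) +
     qsum q a b (\<lambda>x y. even y \<and> 8 dvd x - y - 4)"
proof -
  have "qsum q a b (\<lambda>x y. even y \<and> 8 dvd x - y) =
      qsum q a b (\<lambda>x y. 4 dvd y \<and> 8 dvd x - y) + qsum q a b (\<lambda>x y. 4 dvd y - 2 \<and> 8 dvd x - y)"
    by (rule qsum_split) presburger+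
  moreover have "qsum q a b (\<lambda>x y. even y \<and> 8 dvd x - y - 4) =
      qsum q a b (\<lambda>x y. 4 dvd y \<and> 8 dvd x - y - 4) + qsum q a b (\<lambda>x y. 4 dvd y - 2 \<and> 8 dvd x - y - 4)"
    by (rule qsum_split) presburger+
  moreover have "qsum q a b (\<lambda>x y. 4 dvd y - 2 \<and> 8 dvd x - y) =
      qsum q a b (\<lambda>x y. 4 dvd y - 2 \<and> 8 dvd x - y - 4)"
    by (rule qsum_reflect) presburger
  ultimately show ?thesis by simp
qed

text \<open>With x = 4i and y = 4j, the two classes are those with i + j even and odd, so the
  difference inserts the sign (-1)^(i+j), which is also the sign of (-1)^(i^2 + j^2).\<close>

lemma qsum_4_eq_theta_phi:
  "qsum q a b (\<lambda>x y. 4 dvd y \<and> 8 dvd x - y) - qsum q a b (\<lambda>x y. 4 dvd y \<and> 8 dvd x - y - 4) =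
     theta_phi (- (q ^ (2 * a))) * theta_phi (- (q ^ (2 * b)))"
proof -
  let ?g = "\<lambda>(i::int, j::int). (- (q ^ (2 * a))) ^ nat (i\<^sup>2) * (- (q ^ (2 * b))) ^ nat (j\<^sup>2)"
  have summ: "(\<lambda>n::int. (- (q ^ (2 * k))) ^ nat (n\<^sup>2)) summable_on UNIV" if "k > 0" for k
    using that norm_power_less_1[of "2 * k"] by (intro theta_phi_summable) auto
  note prod = infsum_product_complex[OF summ[OF ab(1)] summ[OF ab(2)]]
  have g: "?g (i, j) = (if even (i + j) then 1 else - 1) * qform q a b (4 * i, 4 * j)" for i j
  proof -
    have "int a * (4 * i)\<^sup>2 + int b * (4 * j)\<^sup>2 = 8 * (2 * int a * i\<^sup>2 + 2 * int b * j\<^sup>2)"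
      by (simp add: power_mult_distrib)
    hence "qform q a b (4 * i, 4 * j) = q ^ nat (2 * int a * i\<^sup>2 + 2 * int b * j\<^sup>2)"
      unfolding qform_def prod.case by (simp only: nonzero_mult_div_cancel_left)
    also have "\<dots> = (q ^ (2 * a)) ^ nat (i\<^sup>2) * (q ^ (2 * b)) ^ nat (j\<^sup>2)"
      by (simp add: nat_add_distrib nat_mult_distrib power_add power_mult)
    moreover have "(- x) ^ nat (k\<^sup>2) = (if even k then 1 else - 1) * x ^ nat (k\<^sup>2)" for x :: complex and k :: int
    proof -
      have "even (nat (k\<^sup>2)) = even k"
        by (simp add: even_nat_iff)
      thus ?thesis by simp
    qed
    ultimately show ?thesis by simp
  qed
  have g': "qform q a b (4 * i, 4 * j) = ?g (i, j)" if "even (i + j)" for i j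
    using that by (simp only: g if_True mult_1)
  have g'': "- qform q a b (4 * i, 4 * j) = ?g (i, j)" if "odd (i + j)" for i j
    using that by (simp only: g if_False minus_mult_left[symmetric] mult_1)
  have "theta_phi (- (q ^ (2 * a))) * theta_phi (- (q ^ (2 * b))) = infsum ?g UNIV"
    using prod(2) by (simp add: theta_phi_def)
  also have "UNIV = {(i::int, j). even (i + j)} \<union> {(i, j). odd (i + j)}"
    by auto
  also have "infsum ?g \<dots> = infsum ?g {(i, j). even (i + j)} + infsum ?g {(i, j). odd (i + j)}"
    by (rule infsum_Un_disjoint) (use prod(1) in \<open>auto elim: summable_on_subset_banach\<close>)
  also have "infsum ?g {(i, j). even (i + j)} = qsum q a b (\<lambda>x y. 4 dvd y \<and> 8 dvd x - y)"
    unfolding qsum_def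
  proof (rule infsum_reindex_bij_witness[of _ "\<lambda>(x, y). (x div 4, y div 4)" "\<lambda>(x, y). (4 * x, 4 * y)"])
    show "(case z of (x, y) \<Rightarrow> (4 * x, 4 * y)) \<in> {(x, y). 4 dvd y \<and> 8 dvd x - y}"
      if "z \<in> {(i, j). even (i + j)}" for z :: "int \<times> int"
      using that by (cases z; simp; presburger)
    show "(case (case z of (x, y) \<Rightarrow> (x div 4, y div 4)) of (x, y) \<Rightarrow> (4 * x, 4 * y)) = z"
      "(case z of (x, y) \<Rightarrow> (x div 4, y div 4)) \<in> {(i, j). even (i + j)}"
      if "z \<in> {(x, y). 4 dvd y \<and> 8 dvd x - y}" for z :: "int \<times> int"
      using that by (cases z; simp; presburger)+
    show "qform q a b (case z of (x, y) \<Rightarrow> (4 * x, 4 * y)) = ?g z"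
      if "z \<in> {(i, j). even (i + j)}" for z
      using that g' by (cases z) (simp only: prod.case mem_Collect_eq)
  qed auto
  also have "infsum ?g {(i, j). odd (i + j)} =
      infsum (\<lambda>z. - qform q a b z) {(x, y). 4 dvd y \<and> 8 dvd x - y - 4}"
  proof (rule infsum_reindex_bij_witness[of _ "\<lambda>(x, y). (x div 4, y div 4)" "\<lambda>(x, y). (4 * x, 4 * y)"])
    show "(case z of (x, y) \<Rightarrow> (4 * x, 4 * y)) \<in> {(x, y). 4 dvd y \<and> 8 dvd x - y - 4}"
      if "z \<in> {(i, j). odd (i + j)}" for z :: "int \<times> int"
      using that by (cases z; simp; presburger)
    show "(case (case z of (x, y) \<Rightarrow> (x div 4, y div 4)) of (x, y) \<Rightarrow> (4 * x, 4 * y)) = z"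
      "(case z of (x, y) \<Rightarrow> (x div 4, y div 4)) \<in> {(i, j). odd (i + j)}"
      if "z \<in> {(x, y). 4 dvd y \<and> 8 dvd x - y - 4}" for z :: "int \<times> int"
      using that by (cases z; simp; presburger)+
    show "- qform q a b (case z of (x, y) \<Rightarrow> (4 * x, 4 * y)) = ?g z"
      if "z \<in> {(i, j). odd (i + j)}" for z
      using that g'' by (cases z) (simp only: prod.case mem_Collect_eq)
  qed auto
  finally show ?thesis
    by (simp add: qsum_def infsum_uminus)
qed

text \<open>For x = 2k - 1 the square is 8 times a triangular number plus 1; the two leftover units
  have weights \<open>a\<close> and \<open>b\<close> and together give the factor q^c.\<close>

lemma qsum_odd_eq_theta_tri:
  assumes "a + b = 8 * c"
  shows "qsum q a b (\<lambda>x y. odd x \<and> odd y) = q ^ c * theta_tri (q ^ a) * theta_tri (q ^ b)"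
proof -
  let ?e = "\<lambda>k::int. nat (k * (k - 1) div 2)"
  have "theta_tri (q ^ a) * theta_tri (q ^ b) =
      (\<Sum>\<^sub>\<infinity>(k, l)\<in>UNIV \<times> UNIV. (q ^ a) ^ ?e k * (q ^ b) ^ ?e l)"
    unfolding theta_tri_def
    by (intro infsum_product_complex summable_on_quadratic_power triangular_bound norm_power_less_1 ab)
  hence "q ^ c * theta_tri (q ^ a) * theta_tri (q ^ b) =
      (\<Sum>\<^sub>\<infinity>z\<in>UNIV. q ^ c * (case z of (k, l) \<Rightarrow> (q ^ a) ^ ?e k * (q ^ b) ^ ?e l))"
    by (simp add: infsum_cmult_right' mult.assoc)
  also have "\<dots> = qsum q a b (\<lambda>x y. odd x \<and> odd y)"
    unfolding qsum_def
  proof (rule infsum_reindex_bij_witness[of _ "\<lambda>(x, y). ((x + 1) div 2, (y + 1) div 2)"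
        "\<lambda>(k, l). (2 * k - 1, 2 * l - 1)"])
    fix z :: "int \<times> int"
    obtain k l where z: "z = (k, l)" by (cases z)
    define u v where "u = k * (k - 1) div 2" and "v = l * (l - 1) div 2"
    have uv: "k * (k - 1) = 2 * u" "l * (l - 1) = 2 * v" "u \<ge> 0" "v \<ge> 0"
      using triangular_bound(2) by (simp_all add: u_def v_def)
    have "(2 * k - 1)\<^sup>2 = 8 * u + 1" "(2 * l - 1)\<^sup>2 = 8 * v + 1"
      using uv(1,2) by (simp_all add: power2_eq_square algebra_simps)
    hence "int a * (2 * k - 1)\<^sup>2 + int b * (2 * l - 1)\<^sup>2 = 8 * (int a * u + int b * v) + int (a + b)"
      by (simp add: algebra_simps)
    also have "\<dots> = 8 * (int a * u + int b * v + int c)"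
      unfolding assms by simp
    finally have "qform q a b (2 * k - 1, 2 * l - 1) = q ^ nat (int a * u + int b * v + int c)"
      unfolding qform_def prod.case by (simp only: nonzero_mult_div_cancel_left)
    also have "\<dots> = q ^ c * ((q ^ a) ^ nat u * (q ^ b) ^ nat v)"
      using uv by (simp add: nat_add_distrib nat_mult_distrib power_add power_mult)
    finally show "qform q a b (case z of (k, l) \<Rightarrow> (2 * k - 1, 2 * l - 1)) =
        q ^ c * (case z of (k, l) \<Rightarrow> (q ^ a) ^ ?e k * (q ^ b) ^ ?e l)"
      by (simp add: z u_def v_def)
  qed (auto elim!: oddE)
  finally show ?thesis ..
qed

end

text \<open>The maps used have the form (u x + v y) div 4 and are exact only on the classes
  \<open>P\<close> and \<open>Q\<close>. They are involutions, so one pair of maps serves in both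
  directions.\<close>

lemma qsum_isometry:
  assumes "\<And>x y. P x y \<Longrightarrow> Q (f x y) (g x y) \<and> f (f x y) (g x y) = x \<and> g (f x y) (g x y) = y"
    and "\<And>x y. Q x y \<Longrightarrow> P (f x y) (g x y) \<and> f (f x y) (g x y) = x \<and> g (f x y) (g x y) = y"
    and "\<And>x y. P x y \<Longrightarrow> int a * (f x y)\<^sup>2 + int b * (g x y)\<^sup>2 = int a * x\<^sup>2 + int b * y\<^sup>2"
  shows "qsum q a b P = qsum q a b Q"
  unfolding qsum_def
  by (rule infsum_reindex_bij_witness[of _ "\<lambda>(x, y). (f x y, g x y)" "\<lambda>(x, y). (f x y, g x y)"])
     (use assms in \<open>auto simp: qform_def\<close>)

text \<open>
  Both identities rest on a rational isometry of the form \<open>a x\<^sup>2 + b y\<^sup>2\<close> that exchanges a class of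
  odd pairs modulo 8 with a class of even pairs.
\<close>
lemma theta_phi_3_5:
  "theta_phi (q ^ 3) * theta_phi (q ^ 5) =
     theta_phi (- (q ^ 2)) * theta_phi (- (q ^ 30)) + q ^ 2 * theta_tri q * theta_tri (q ^ 15) / 2"
proof -
  let ?S = "qsum q 1 15"
  have "theta_phi (q ^ 3) * theta_phi (q ^ 5) = ?S (\<lambda>x y. 8 dvd x - 3 * y)"
    unfolding theta_phi_mult[OF q(1), of 3 5, simplified] qsum_def
  \<comment> \<open>The substitution multiplies the form by 8, and x - 3y = 8n, so its image is the
    whole class and the quotient recovers n.\<close>
  proof (rule infsum_reindex_bij_witness[of _ "\<lambda>(x, y). (y + (x - 3 * y) div 8, (x - 3 * y) div 8)"
        "\<lambda>(m, n). (3 * m + 5 * n, m - n)"])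
    fix z :: "int \<times> int"
    obtain m n where z: "z = (m, n)" by (cases z)
    have "(3 * m + 5 * n)\<^sup>2 + 15 * (m - n)\<^sup>2 = 8 * (3 * m\<^sup>2 + 5 * n\<^sup>2)"
      by (simp add: power2_eq_square algebra_simps)
    thus "qform q 1 15 (case z of (m, n) \<Rightarrow> (3 * m + 5 * n, m - n)) =
        (case z of (m, n) \<Rightarrow> q ^ nat (3 * m\<^sup>2 + 5 * n\<^sup>2))"
      unfolding qform_def z prod.case by simp
  qed (auto elim!: dvdE simp: algebra_simps)
  also have "\<dots> = ?S (\<lambda>x y. odd y \<and> 8 dvd x - 3 * y) + ?S (\<lambda>x y. even y \<and> 8 dvd x + y)"
    by (rule qsum_split) (simp_all, presburger+)
  also have "?S (\<lambda>x y. even y \<and> 8 dvd x + y) = ?S (\<lambda>x y. even y \<and> 8 dvd x - y)"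
    by (rule qsum_reflect) simp_all
  also have "\<dots> = theta_phi (- (q ^ 2)) * theta_phi (- (q ^ 30)) + ?S (\<lambda>x y. even y \<and> 8 dvd x - y - 4)"
    using qsum_even_split[of 1 15] qsum_4_eq_theta_phi[of 1 15] by simp
  also have "?S (\<lambda>x y. even y \<and> 8 dvd x - y - 4) = ?S (\<lambda>x y. odd y \<and> 8 dvd x - y)"
  \<comment> \<open>The difference x - y is 4 modulo 8 on the even class, so both quotients by 4 are
    integers and odd.\<close>
  proof (rule qsum_isometry[where f = "\<lambda>x y. (x + 15 * y) div 4" and g = "\<lambda>x y. (x - y) div 4"], goal_cases)
    case (1 x y)
    then obtain c d where cd: "y = 2 * d" "x = y + 4 + 8 * c"
      by (auto elim!: evenE dvdE simp: algebra_simps)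
    show ?case unfolding cd by (simp; presburger)
  next
    case (2 x y)
    then obtain c d where cd: "y = 2 * d + 1" "x = y + 8 * c"
      by (auto elim!: oddE dvdE simp: algebra_simps)
    show ?case unfolding cd by (simp; presburger)
  next
    case (3 x y)
    then obtain c d where cd: "y = 2 * d" "x = y + 4 + 8 * c"
      by (auto elim!: evenE dvdE simp: algebra_simps)
    have "(x + 15 * y) div 4 = 8 * d + 1 + 2 * c" "(x - y) div 4 = 1 + 2 * c"
      unfolding cd by simp_all
    thus ?case unfolding cd by (simp add: power2_eq_square algebra_simps)
  qed
  \<comment> \<open>The two odd classes that remain, for y and 3y, make up half of all odd
    pairs.\<close>
  finally show ?thesis
    using qsum_odd_split[of 1 15] qsum_odd_eq_theta_tri[of 1 15 2] by (simp add: field_simps)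
qed

lemma theta_phi_1_15:
  "theta_phi q * theta_phi (q ^ 15) =
     theta_phi (- (q ^ 6)) * theta_phi (- (q ^ 10)) + q * theta_tri (q ^ 3) * theta_tri (q ^ 5) / 2"
proof -
  let ?S = "qsum q 3 5"
  have "theta_phi q * theta_phi (q ^ 15) = ?S (\<lambda>x y. 8 dvd x - y)"
    unfolding theta_phi_mult[OF q(1), of 1 15, simplified] qsum_def
  proof (rule infsum_reindex_bij_witness[of _ "\<lambda>(x, y). (y + 3 * ((x - y) div 8), (x - y) div 8)"
        "\<lambda>(m, n). (m + 5 * n, m - 3 * n)"])
    fix z :: "int \<times> int"
    obtain m n where z: "z = (m, n)" by (cases z)
    have "3 * (m + 5 * n)\<^sup>2 + 5 * (m - 3 * n)\<^sup>2 = 8 * (m\<^sup>2 + 15 * n\<^sup>2)"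
      by (simp add: power2_eq_square algebra_simps)
    thus "qform q 3 5 (case z of (m, n) \<Rightarrow> (m + 5 * n, m - 3 * n)) =
        (case z of (m, n) \<Rightarrow> q ^ nat (m\<^sup>2 + 15 * n\<^sup>2))"
      unfolding qform_def z prod.case by simp
  qed (auto elim!: dvdE simp: algebra_simps)
  also have "\<dots> = ?S (\<lambda>x y. odd y \<and> 8 dvd x - y) + ?S (\<lambda>x y. even y \<and> 8 dvd x - y)"
    by (rule qsum_split) auto
  also have "?S (\<lambda>x y. even y \<and> 8 dvd x - y) =
      theta_phi (- (q ^ 6)) * theta_phi (- (q ^ 10)) + ?S (\<lambda>x y. even y \<and> 8 dvd x - y - 4)"
    using qsum_even_split[of 3 5] qsum_4_eq_theta_phi[of 3 5] by simp
  \<comment> \<open>The reflection prepares for the isometry: with x = 4 - y modulo 8 both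
    coordinates of the image are odd, whereas for x = 4 + y their parity would vary.\<close>
  also have "?S (\<lambda>x y. even y \<and> 8 dvd x - y - 4) = ?S (\<lambda>x y. even y \<and> 8 dvd x + y - 4)"
    by (rule qsum_reflect) simp_all
  also have "\<dots> = ?S (\<lambda>x y. odd y \<and> 8 dvd x - 3 * y)"
  proof (rule qsum_isometry[where f = "\<lambda>x y. (x + 5 * y) div 4" and g = "\<lambda>x y. (3 * x - y) div 4"], goal_cases)
    case (1 x y)
    then obtain c d where cd: "y = 2 * d" "x = - y + 4 + 8 * c"
      by (auto elim!: evenE dvdE simp: algebra_simps)
    show ?case unfolding cd by (simp; presburger)
  next
    case (2 x y)
    then obtain c d where cd: "y = 2 * d + 1" "x = 3 * y + 8 * c"
      by (auto elim!: oddE dvdE simp: algebra_simps)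
    show ?case unfolding cd by (simp; presburger)
  next
    case (3 x y)
    then obtain c d where cd: "y = 2 * d" "x = - y + 4 + 8 * c"
      by (auto elim!: evenE dvdE simp: algebra_simps)
    have "(x + 5 * y) div 4 = 1 + 2 * c + 2 * d" "(3 * x - y) div 4 = 3 + 6 * c - 2 * d"
      unfolding cd by simp_all
    thus ?case unfolding cd by (simp add: power2_eq_square algebra_simps)
  qed
  finally show ?thesis
    using qsum_odd_split[of 3 5] qsum_odd_eq_theta_tri[of 3 5 1] by (simp add: field_simps)
qed

end

section \<open>The theta products in terms of P and Q\<close>

text \<open>
  Here \<open>a\<close>, \<open>b\<close>, \<open>v\<close>, \<open>g\<close> are \<open>\<phi>(-q^m) \<phi>(-q^n)\<close> for \<open>(m, n) = (1, 15), (3, 5), (2, 30), (6, 10)\<close>,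
  and \<open>c\<close>, \<open>d\<close> are the \<open>\<psi>\<close> terms; the hypotheses are the two theta identities at \<open>-q\<close> and at \<open>q\<close>.
\<close>
lemma eliminate_theta_relations:
  fixes a b c d g v :: complex
  assumes eqs: "v * b = v\<^sup>2 + c * a" "g\<^sup>2 = b * (v + c)" "g * a = g\<^sup>2 - d * b" "v\<^sup>2 = a * (g + d)"
    and nz: "a \<noteq> 0" "b \<noteq> 0" "g \<noteq> 0" "g + b \<noteq> 0"
  shows "4 * a * b * d = (b - a) * (a + b)\<^sup>2" "c * (a + b) ^ 3 = 4 * a * b * d\<^sup>2"
proof -
  \<comment> \<open>\<open>c\<close> and \<open>d\<close> occur linearly, so they are solved for
    first; what remains are two equations for \<open>v\<close>, one quadratic and one
    linear.\<close>
  have db: "d * b = g * (g - a)" and cb: "c * b = g\<^sup>2 - b * v"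
    using eqs(2,3) by (simp_all add: algebra_simps power2_eq_square)
  have "b * v\<^sup>2 = a * (b * g + d * b)"
    unfolding eqs(4) by (simp add: algebra_simps)
  hence vb: "b * v\<^sup>2 = a * g * (b + g - a)"
    unfolding db by (simp add: algebra_simps)
  have "b * (v * b) = b * v\<^sup>2 + (c * b) * a"
    unfolding eqs(1) by (simp add: algebra_simps)
  hence "v * b * (a + b) = a * g * (b + g - a) + a * g\<^sup>2"
    unfolding cb vb by (simp add: algebra_simps)
  hence vab: "v * b * (a + b) = a * g * (b + 2 * g - a)"
    by (simp add: algebra_simps power2_eq_square)
  \<comment> \<open>Squaring the linear equation \<open>vab\<close> and inserting the quadratic one
    \<open>vb\<close> eliminates \<open>v\<close>.\<close>
  have "(a * g) * (b * (b + g - a) * (a + b)\<^sup>2) = (a * g) * (a * g * (b + 2 * g - a)\<^sup>2)"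
  proof -
    have "(a * g) * (b * (b + g - a) * (a + b)\<^sup>2) = b * (b * v\<^sup>2) * (a + b)\<^sup>2"
      unfolding vb by (simp add: algebra_simps)
    also have "\<dots> = (v * b * (a + b))\<^sup>2"
      by (simp add: power_mult_distrib power2_eq_square mult_ac)
    also have "\<dots> = (a * g) * (a * g * (b + 2 * g - a)\<^sup>2)"
      unfolding vab by (simp add: power_mult_distrib power2_eq_square mult_ac)
    finally show ?thesis .
  qed
  hence "b * (b + g - a) * (a + b)\<^sup>2 = a * g * (b + 2 * g - a)\<^sup>2"
    using nz by simp
  \<comment> \<open>As a polynomial in \<open>g\<close>, the difference of the two sides has the
    extraneous root -b; the other factor is the relation sought.\<close>
  hence "(g + b) * (4 * a * (g * (g - a)) - (b - a) * (a + b)\<^sup>2) = 0"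
    by (simp add: algebra_simps power2_eq_square)
  hence "4 * a * (d * b) = (b - a) * (a + b)\<^sup>2"
    unfolding db using nz by simp
  thus 1: "4 * a * b * d = (b - a) * (a + b)\<^sup>2"
    by (simp add: mult_ac)
  have "b * (c * (a + b)) = (c * b) * (a + b)"
    by (simp add: mult_ac)
  also have "\<dots> = g\<^sup>2 * (a + b) - v * b * (a + b)"
    unfolding cb by (simp add: algebra_simps)
  also have "\<dots> = (b - a) * (d * b)"
    unfolding vab db by (simp add: algebra_simps power2_eq_square)
  finally have "b * (c * (a + b)) = b * ((b - a) * d)"
    by (simp add: mult_ac)
  hence "c * (a + b) = (b - a) * d"
    using nz by simp
  moreover have "c * (a + b) ^ 3 = c * (a + b) * (a + b)\<^sup>2"
    by (simp add: power3_eq_cube power2_eq_square mult_ac)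
  ultimately have "c * (a + b) ^ 3 = (b - a) * (a + b)\<^sup>2 * d"
    by (simp only: mult_ac)
  also have "\<dots> = 4 * a * b * d\<^sup>2"
    unfolding 1[symmetric] by (simp add: power2_eq_square)
  finally show "c * (a + b) ^ 3 = 4 * a * b * d\<^sup>2" .
qed

context punctured_disc
begin

lemma punctured_disc_power: "k > 0 \<Longrightarrow> punctured_disc (q ^ k)"
  using norm_power_less_1 q by unfold_locales auto

lemma punctured_disc_uminus: "punctured_disc (- q)"
  using q by unfold_locales auto

text \<open>Both E(-q) and (-q; q) = E(q^2)/E(q) contain the odd part (-q; q^2), which is eliminated
  between them.\<close>

lemma euler_E_uminus: "euler_E (- q) = (euler_E (q ^ 2)) ^ 3 / (euler_E q * euler_E (q ^ 4))"
proof -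
  have "euler_E (- q) = qpoch (- q) (q\<^sup>2) * euler_E (q\<^sup>2)"
    using qpoch_split[of "- q" 2 "- q"] q
    by (simp add: euler_E_eq_qpoch lessThan_Suc numeral_2_eq_2 power2_eq_square mult.commute)
  moreover have "euler_E (q\<^sup>2) / euler_E q = qpoch (- q) (q\<^sup>2) * (euler_E (q ^ 4) / euler_E (q\<^sup>2))"
    using qpoch_split[of q 2 "- q"] q qpoch_uminus_self[OF q(1)]
      qpoch_uminus_self[OF norm_power_less_1[of 2]]
    by (simp add: lessThan_Suc numeral_2_eq_2 power2_eq_square mult.commute numeral_eq_Suc mult.assoc)
  ultimately show ?thesis
    using euler_E_nz[of 1] euler_E_nz[of 2] euler_E_nz[of 4]
    by (simp add: field_simps power3_eq_cube power2_eq_square)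
qed

lemma theta_phi_eq:
  "theta_phi q = (euler_E (q ^ 2)) ^ 5 / ((euler_E q)\<^sup>2 * (euler_E (q ^ 4))\<^sup>2)"
proof -
  have *: "(x ^ 3 / (y * z))\<^sup>2 / x = x ^ 5 / (y\<^sup>2 * z\<^sup>2)" if "x \<noteq> 0" for x y z :: complex
    using that by (simp add: field_simps eval_nat_numeral)
  have "theta_phi q = (euler_E (- q))\<^sup>2 / euler_E (q ^ 2)"
    using punctured_disc.theta_phi_uminus[OF punctured_disc_uminus] by simp
  thus ?thesis
    unfolding euler_E_uminus *[OF euler_E_nz[OF pos2]] .
qed

lemma theta_tri_uminus: "theta_tri (- q) = 2 * euler_E q * euler_E (q ^ 4) / euler_E (q ^ 2)"
proof -
  have *: "2 * x\<^sup>2 / (x ^ 3 / (y * z)) = 2 * y * z / x" if "x \<noteq> 0" for x y z :: complex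
    using that by (simp add: field_simps eval_nat_numeral)
  have "theta_tri (- q) = 2 * (euler_E (q ^ 2))\<^sup>2 / euler_E (- q)"
    using punctured_disc.theta_tri_eq[OF punctured_disc_uminus] by simp
  thus ?thesis
    unfolding euler_E_uminus *[OF euler_E_nz[OF pos2]] .
qed

lemmas theta_phi_uminus_power = punctured_disc.theta_phi_uminus[OF punctured_disc_power]
lemmas theta_phi_power = punctured_disc.theta_phi_eq[OF punctured_disc_power]
lemmas theta_tri_power = punctured_disc.theta_tri_eq[OF punctured_disc_power]
lemmas theta_tri_uminus_power = punctured_disc.theta_tri_uminus[OF punctured_disc_power]

text \<open>The three conditions of nonvanishing hold near 0. They allow, in turn, cancelling g + b
  in the elimination, dividing by (a + b)^2, and concluding 2 P = a + b from the equality of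
  cubes.\<close>

lemma P_Q_quotient_local:
  defines "a \<equiv> theta_phi (- q) * theta_phi (- (q ^ 15))"
    and "b \<equiv> theta_phi (- (q ^ 3)) * theta_phi (- (q ^ 5))"
    and "g \<equiv> theta_phi (- (q ^ 6)) * theta_phi (- (q ^ 10))"
    and "P \<equiv> P_quotient q"
  assumes gb: "g + b \<noteq> 0" and ab: "a + b \<noteq> 0"
    and cube: "(2 * P)\<^sup>2 + 2 * P * (a + b) + (a + b)\<^sup>2 \<noteq> 0"
  shows "a = P - Q_quotient q" "b = P + Q_quotient q"
proof -
  \<comment> \<open>Every quantity is a monomial in E(q^k) E(q^(15k)) and E(q^(3k)) E(q^(5k)) for k
    = 1, 2, 4, up to powers of q and constants, so the remaining checks are exponent counts.\<close>
  define e1 e2 e4 f1 f2 f4 where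
    "e1 = euler_E q * euler_E (q ^ 15)" and "e2 = euler_E (q ^ 2) * euler_E (q ^ 30)" and
    "e4 = euler_E (q ^ 4) * euler_E (q ^ 60)" and "f1 = euler_E (q ^ 3) * euler_E (q ^ 5)" and
    "f2 = euler_E (q ^ 6) * euler_E (q ^ 10)" and "f4 = euler_E (q ^ 12) * euler_E (q ^ 20)"
  note ef = e1_def e2_def e4_def f1_def f2_def f4_def
  have nz: "e1 \<noteq> 0" "e2 \<noteq> 0" "e4 \<noteq> 0" "f1 \<noteq> 0" "f2 \<noteq> 0" "f4 \<noteq> 0"
    using euler_E_nz euler_E_nz[of 1] by (simp_all add: ef)
  define v c d where "v = e2\<^sup>2 / e4" and "c = 2 * q\<^sup>2 * e2\<^sup>2 / e1" and "d = 2 * q * f2\<^sup>2 / f1"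
  have a: "a = e1\<^sup>2 / e2" and b: "b = f1\<^sup>2 / f2" and g: "g = f2\<^sup>2 / f4"
    by (simp_all add: a_def b_def g_def ef theta_phi_uminus theta_phi_uminus_power power_mult_distrib
          flip: power_mult)
  have v: "theta_phi (- (q ^ 2)) * theta_phi (- (q ^ 30)) = v"
    by (simp add: v_def ef theta_phi_uminus_power power_mult_distrib flip: power_mult)
  have abgv: "a \<noteq> 0" "b \<noteq> 0" "g \<noteq> 0" "v \<noteq> 0" "c \<noteq> 0" "d \<noteq> 0"
    using nz q by (simp_all add: a b g v_def c_def d_def)
  have "theta_phi (q ^ 3) * theta_phi (q ^ 5) = f2 ^ 5 / (f1\<^sup>2 * f4\<^sup>2)"
    by (simp add: ef theta_phi_power power_mult_distrib flip: power_mult)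
  moreover have "q ^ 2 * theta_tri q * theta_tri (q ^ 15) / 2 = c"
    by (simp add: c_def ef theta_tri_eq theta_tri_power power_mult_distrib flip: power_mult)
  ultimately have "f2 ^ 5 / (f1\<^sup>2 * f4\<^sup>2) = v + c"
    using theta_phi_3_5 v by simp
  moreover have "f2 ^ 5 / (f1\<^sup>2 * f4\<^sup>2) = g\<^sup>2 / b"
    using nz by (simp add: g b field_simps eval_nat_numeral)
  ultimately have 1: "g\<^sup>2 = b * (v + c)"
    using abgv by (simp add: field_simps)
  have "theta_phi q * theta_phi (q ^ 15) = e2 ^ 5 / (e1\<^sup>2 * e4\<^sup>2)"
    by (simp add: ef theta_phi_eq theta_phi_power power_mult_distrib flip: power_mult)
  moreover have "q * theta_tri (q ^ 3) * theta_tri (q ^ 5) / 2 = d"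
    by (simp add: d_def ef theta_tri_power power_mult_distrib flip: power_mult)
  ultimately have "e2 ^ 5 / (e1\<^sup>2 * e4\<^sup>2) = g + d"
    using theta_phi_1_15 by (simp add: g_def)
  moreover have "e2 ^ 5 / (e1\<^sup>2 * e4\<^sup>2) = v\<^sup>2 / a"
    using nz by (simp add: v_def a field_simps eval_nat_numeral)
  ultimately have 2: "v\<^sup>2 = a * (g + d)"
    using abgv by (simp add: field_simps)
  \<comment> \<open>The same theta identity at -q: even powers of q stay, and the odd powers turn
    the left side into \<open>b\<close>. In the second identity below, the prefactor q changes sign
    as well.\<close>
  have "b = v + q ^ 2 * theta_tri (- q) * theta_tri (- (q ^ 15)) / 2"
    using punctured_disc.theta_phi_3_5[OF punctured_disc_uminus] v by (simp add: b_def)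
  moreover have "q ^ 2 * theta_tri (- q) * theta_tri (- (q ^ 15)) / 2 = 2 * q\<^sup>2 * e1 * e4 / e2"
    by (simp add: ef theta_tri_uminus theta_tri_uminus_power flip: power_mult)
  moreover have "2 * q\<^sup>2 * e1 * e4 / e2 = c * a / v"
    using nz by (simp add: c_def a v_def field_simps power2_eq_square)
  ultimately have "b = v + c * a / v"
    by (simp only:)
  hence 3: "v * b = v\<^sup>2 + c * a"
    using abgv by (simp add: field_simps power2_eq_square)
  have "a = g - q * theta_tri (- (q ^ 3)) * theta_tri (- (q ^ 5)) / 2"
    using punctured_disc.theta_phi_1_15[OF punctured_disc_uminus] by (simp add: a_def g_def)
  moreover have "q * theta_tri (- (q ^ 3)) * theta_tri (- (q ^ 5)) / 2 = 2 * q * f1 * f4 / f2"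
    by (simp add: ef theta_tri_uminus_power flip: power_mult)
  moreover have "2 * q * f1 * f4 / f2 = d * b / g"
    using nz by (simp add: d_def b g field_simps power2_eq_square)
  ultimately have "a = g - d * b / g"
    by (simp only:)
  hence 4: "g * a = g\<^sup>2 - d * b"
    using abgv by (simp add: field_simps power2_eq_square)
  note elim = eliminate_theta_relations[OF 3 1 4 2 abgv(1-3) gb]
  have P: "P = e1 * f2 / e2" and Q: "Q_quotient q = q * (e2 * f1 / f2)"
    by (simp_all add: P_def P_quotient_def Q_quotient_def ef mult_ac)
  \<comment> \<open>As products both sides are 16 q^2 e1^2 f2^3 / e2, so the second elimination
    formula compares the two cubes.\<close>
  have "c * (2 * P) ^ 3 = 4 * a * b * d\<^sup>2"
    using nz by (simp add: P a b c_def d_def field_simps eval_nat_numeral)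
  also have "\<dots> = c * (a + b) ^ 3"
    by (rule elim(2)[symmetric])
  finally have "(2 * P) ^ 3 = (a + b) ^ 3"
    using mult_left_cancel[OF abgv(5)] by blast
  hence "(2 * P - (a + b)) * ((2 * P)\<^sup>2 + 2 * P * (a + b) + (a + b)\<^sup>2) = 0"
    by (simp add: algebra_simps power2_eq_square power3_eq_cube)
  hence 2: "2 * P = a + b"
    using cube by simp
  have "8 * (Q_quotient q * P\<^sup>2) = 4 * a * b * d"
    using nz by (simp add: P Q a b d_def field_simps power2_eq_square)
  hence "2 * Q_quotient q * (2 * P)\<^sup>2 = (b - a) * (a + b)\<^sup>2"
    unfolding elim(1) by (simp add: power_mult_distrib)
  hence "2 * Q_quotient q = b - a"
    unfolding 2 using ab by simp
  with 2 have "2 * a = 2 * (P - Q_quotient q)" "2 * b = 2 * (P + Q_quotient q)"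
    by (simp_all add: algebra_simps)
  thus "a = P - Q_quotient q" "b = P + Q_quotient q"
    by (metis mult_cancel_left zero_neq_numeral)+
qed

end

section \<open>The identities near 0 and their continuation to the unit disc\<close>

lemma theta_phi_0: "theta_phi 0 = 1"
proof -
  have "theta_phi 0 = (\<Sum>\<^sub>\<infinity>n\<in>{0::int}. 0 ^ nat (n\<^sup>2))"
    unfolding theta_phi_def by (rule infsum_cong_neutral) auto
  thus ?thesis by simp
qed

lemma euler_E_0: "euler_E 0 = 1"
  by (simp add: euler_E_def)

lemma holomorphic_euler_E_power:
  assumes "k > 0"
  shows "(\<lambda>q. euler_E (q ^ k)) holomorphic_on ball 0 1"
proof -
  have "(euler_E \<circ> (\<lambda>q. q ^ k)) holomorphic_on ball 0 1"
    by (rule holomorphic_on_compose_gen[OF _ holomorphic_euler_E])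
       (use assms in \<open>auto intro!: holomorphic_intros simp: norm_power power_less_one_iff\<close>)
  thus ?thesis by (simp add: o_def)
qed

text \<open>The triple product excludes q = 0, where both sides equal 1. With the centre included,
  the product side shows that the theta series is holomorphic on the whole disc.\<close>

lemma theta_phi_uminus_power_disc:
  assumes "norm q < 1" "k > 0"
  shows "theta_phi (- (q ^ k)) = (euler_E (q ^ k))\<^sup>2 / euler_E (q ^ (2 * k))"
proof (cases "q = 0")
  case True
  thus ?thesis using assms by (simp add: theta_phi_0 euler_E_0 power_0_left)
next
  case False
  then interpret punctured_disc "q ^ k"
    using assms by unfold_locales (auto simp: norm_power power_less_one_iff)
  show ?thesis
    using theta_phi_uminus by (simp add: mult.commute flip: power_mult)
qed

lemma holomorphic_theta_phi_uminus_power: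
  assumes "k > 0"
  shows "(\<lambda>q. theta_phi (- (q ^ k))) holomorphic_on ball 0 1"
proof -
  have "(\<lambda>q. (euler_E (q ^ k))\<^sup>2 / euler_E (q ^ (2 * k))) holomorphic_on ball 0 1"
    using assms
    by (intro holomorphic_intros holomorphic_euler_E_power euler_E_nonzero)
       (auto simp: norm_power power_less_one_iff)
  thus ?thesis
    by (rule holomorphic_transform) (use assms in \<open>simp add: theta_phi_uminus_power_disc\<close>)
qed

lemma holomorphic_P_quotient: "P_quotient holomorphic_on ball 0 1"
  unfolding P_quotient_def[abs_def]
  by (intro holomorphic_intros holomorphic_euler_E_power holomorphic_euler_E)
     (auto simp: euler_E_nonzero norm_power power_less_one_iff)

lemma holomorphic_Q_quotient: "Q_quotient holomorphic_on ball 0 1"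
  unfolding Q_quotient_def[abs_def]
  by (intro holomorphic_intros holomorphic_euler_E_power)
     (auto simp: euler_E_nonzero norm_power power_less_one_iff)

text \<open>The identity theorem, with 0 as accumulation point of the zero set.\<close>

lemma eventually_zero_imp_zero_on_disc:
  assumes "f holomorphic_on ball 0 1" "\<forall>\<^sub>F z in at 0. f z = 0" "norm q < 1"
  shows "f q = 0"
proof (rule analytic_continuation[OF assms(1)])
  show "{z \<in> ball 0 1. f z = 0} \<subseteq> ball 0 1" by auto
  have "\<forall>\<^sub>F z in at (0::complex). z \<in> ball 0 1"
    by (rule eventually_at_in_open') auto
  with assms(2) have "\<forall>\<^sub>F z in at 0. z \<in> {z \<in> ball 0 1. f z = 0}"
    by eventually_elim auto
  hence "\<exists>\<^sub>F z in at 0. z \<in> {z \<in> ball 0 1. f z = 0}"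
    by (intro eventually_frequently) auto
  hence "\<not> (\<forall>\<^sub>F z in at 0. z \<notin> {z \<in> ball 0 1. f z = 0})"
    unfolding frequently_def .
  thus "(0::complex) islimpt {z \<in> ball 0 1. f z = 0}"
    by (simp add: islimpt_iff_eventually)
qed (use assms in auto)

lemma eventually_P_Q_quotient:
  "\<forall>\<^sub>F q in at 0. theta_phi (- q) * theta_phi (- (q ^ 15)) = P_quotient q - Q_quotient q \<and>
     theta_phi (- (q ^ 3)) * theta_phi (- (q ^ 5)) = P_quotient q + Q_quotient q"
proof -
  let ?a = "\<lambda>q. theta_phi (- (q ^ 1)) * theta_phi (- (q ^ 15))"
  let ?b = "\<lambda>q. theta_phi (- (q ^ 3)) * theta_phi (- (q ^ 5))"
  let ?g = "\<lambda>q. theta_phi (- (q ^ 6)) * theta_phi (- (q ^ 10))"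
  have cont: "isCont f 0" if "f holomorphic_on ball 0 1" for f :: "complex \<Rightarrow> complex"
    using holomorphic_on_imp_continuous_on[OF that] by (simp add: continuous_on_eq_continuous_at)
  have "isCont (\<lambda>q. theta_phi (- (q ^ k))) 0" if "k > 0" for k
    using that by (intro cont holomorphic_theta_phi_uminus_power)
  hence th: "((\<lambda>q. theta_phi (- (q ^ k))) \<longlongrightarrow> 1) (at 0)" if "k > 0" for k
    using that by (fastforce simp: isCont_def theta_phi_0 power_0_left)
  have P: "(P_quotient \<longlongrightarrow> 1) (at 0)"
    using cont[OF holomorphic_P_quotient] by (simp add: isCont_def P_quotient_def euler_E_0)
  \<comment> \<open>Every theta product and P tend to 1, so the three conditions have limits 2, 2
    and 12.\<close>
  have "((\<lambda>q. ?g q + ?b q) \<longlongrightarrow> 1 * 1 + 1 * 1) (at 0)"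
    "((\<lambda>q. ?a q + ?b q) \<longlongrightarrow> 1 * 1 + 1 * 1) (at 0)"
    "((\<lambda>q. (2 * P_quotient q)\<^sup>2 + 2 * P_quotient q * (?a q + ?b q) + (?a q + ?b q)\<^sup>2) \<longlongrightarrow>
       (2 * 1)\<^sup>2 + 2 * 1 * (1 * 1 + 1 * 1) + (1 * 1 + 1 * 1)\<^sup>2) (at 0)"
    by (intro tendsto_intros th P; simp)+
  hence "\<forall>\<^sub>F q in at 0. ?g q + ?b q \<noteq> 0" "\<forall>\<^sub>F q in at 0. ?a q + ?b q \<noteq> 0"
    "\<forall>\<^sub>F q in at 0. (2 * P_quotient q)\<^sup>2 + 2 * P_quotient q * (?a q + ?b q) + (?a q + ?b q)\<^sup>2 \<noteq> 0"
    by (auto elim!: tendsto_imp_eventually_ne)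
  moreover have "\<forall>\<^sub>F q in at (0::complex). q \<in> ball 0 1 - {0}"
    by (rule eventually_at_in_open) auto
  ultimately show ?thesis
  proof eventually_elim
    case (elim q)
    then interpret punctured_disc q by unfold_locales auto
    show ?case using P_Q_quotient_local elim by simp
  qed
qed

lemma theta_phi_mult_eq_P_Q_quotient:
  assumes "norm q < 1"
  shows "theta_phi (- q) * theta_phi (- (q ^ 15)) = P_quotient q - Q_quotient q"
    and "theta_phi (- (q ^ 3)) * theta_phi (- (q ^ 5)) = P_quotient q + Q_quotient q"
proof -
  have hol: "(\<lambda>q. theta_phi (- (q ^ k))) holomorphic_on ball 0 1" if "k > 0" for k
    by (rule holomorphic_theta_phi_uminus_power[OF that])
  have "theta_phi (- q) * theta_phi (- (q ^ 15)) - (P_quotient q - Q_quotient q) = 0"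
    by (rule eventually_zero_imp_zero_on_disc[OF _ _ assms])
       (use hol[of 1] eventually_P_Q_quotient in
         \<open>auto intro!: holomorphic_intros hol holomorphic_P_quotient holomorphic_Q_quotient
            elim!: eventually_mono\<close>)
  moreover have "theta_phi (- (q ^ 3)) * theta_phi (- (q ^ 5)) - (P_quotient q + Q_quotient q) = 0"
    by (rule eventually_zero_imp_zero_on_disc[OF _ _ assms])
       (use eventually_P_Q_quotient in
         \<open>auto intro!: holomorphic_intros hol holomorphic_P_quotient holomorphic_Q_quotient
            elim!: eventually_mono\<close>)
  ultimately show "theta_phi (- q) * theta_phi (- (q ^ 15)) = P_quotient q - Q_quotient q"
    "theta_phi (- (q ^ 3)) * theta_phi (- (q ^ 5)) = P_quotient q + Q_quotient q"
    by simp_all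
qed

theorem theorem5p1:
  fixes q :: complex
  assumes "norm q < 1"
  shows
    "P_quotient q =
       1 - (\<Sum>n. of_int (kronecker (- 15) (int (Suc n))) * (q ^ Suc n / (1 + q ^ Suc n))) \<and>
     Q_quotient q =
       (\<Sum>n. of_int (kronecker 5 (int (Suc n))) *
             (q ^ Suc n * (1 + q ^ Suc n) / (1 + q ^ (3 * Suc n)))) \<and>
     theta_phi (- q) * theta_phi (- (q ^ 15)) = P_quotient q - Q_quotient q \<and>
     P_quotient q - Q_quotient q =
       1 - (\<Sum>n. of_int (kronecker (- 15) (int (Suc n))) * (q ^ Suc n / (1 + q ^ Suc n)))
         - (\<Sum>n. of_int (kronecker 5 (int (Suc n))) *
                 (q ^ Suc n * (1 + q ^ Suc n) / (1 + q ^ (3 * Suc n)))) \<and>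
     theta_phi (- (q ^ 3)) * theta_phi (- (q ^ 5)) = P_quotient q + Q_quotient q \<and>
     P_quotient q + Q_quotient q =
       1 - (\<Sum>n. of_int (kronecker (- 15) (int (Suc n))) * (q ^ Suc n / (1 + q ^ Suc n)))
         + (\<Sum>n. of_int (kronecker 5 (int (Suc n))) *
                 (q ^ Suc n * (1 + q ^ Suc n) / (1 + q ^ (3 * Suc n))))"
proof (cases "q = 0")
  case True
  have "P_quotient q = 1" "Q_quotient q = 0"
    by (simp_all add: True P_quotient_def Q_quotient_def euler_E_0)
  thus ?thesis
    by (simp add: True theta_phi_0)
next
  case False
  interpret punctured_disc q
    using assms False by unfold_locales
  show ?thesis
    unfolding theta_phi_mult_eq_P_Q_quotient[OF assms]
    using P_quotient_eq_lambert Q_quotient_eq_lambert by (metis (no_types, lifting))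
qed

end
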